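(* Consider a monotone-separable network satisfying (IA) (see the context) and the stability condition $\lambda\gamma(0)<1$, and let $\alpha>1$. If $\mathbf{E}Z_0^\alpha<\infty$, then $\mathbf{E}Z_{(-\infty,0]}^{\alpha-1}<\infty$.
   Context: Monotone-separable network. The input $N=\{T_n\}_{n\in\mathbb{Z}}$ is a nondecreasing real sequence of arrival epochs, $\tau_n=T_{n+1}-T_n$, and $\{\zeta_n\}_{n\in\mathbb{Z}}$ is a sequence with values in a measurable space $K$ (service times and routing decisions). There are measurable functions $f_l:\mathbb{R}^l\times K^l\to\mathbb{R}$, $l\ge1$, and for $m\le n$ one puts $X_{[m,n]}(N)=f_{n-m+1}\{(T_l,\zeta_l),\,m\le l\le n\}$ (the finite time of last activity when the network starts empty and is fed by $T_m,\ldots,T_n$). For all inputs $N$ and all $m\le n$ it is required that: (causality) $X_{[m,n]}(N)\ge T_n$; (external monotonicity) $X_{[m,n]}(N')\ge X_{[m,n]}(N)$ whenever $T'_k\ge T_k$ for all $k$; (homogeneity) $X_{[m,n]}(c+N)=X_{[m,n]}(N)+c$ for all $c\in\mathbb{R}$; (separability) for $m\le l<n$, if $X_{[m,l]}(N)\le T_{l+1}$ then $X_{[m,n]}(N)=X_{[l+1,n]}(N)$. Maximal daters: $Z_{[m,n]}(N)=X_{[m,n]}(N)-T_n$; $Z_n=Z_{[n,n]}(N)$ (which does not depend on $N$). The sequence $Z_{[-n,0]}(N)$ is nondecreasing in $n$, and $Z_{(-\infty,0]}=\lim_{n\to\infty}Z_{[-n,0]}(N)$ is the stationary maximal dater. Stochastic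 assumptions: $\{(\tau_n,\zeta_n)\}$ is stationary and ergodic, $\mathbf{E}\tau_n=a=\lambda^{-1}<\infty$, $\mathbf{E}Z_n<\infty$. With $Q$ the degenerate input with all points equal to $0$, $\gamma(0)=\lim_n Z_{[-n,-1]}(Q)/n=\lim_n\mathbf{E}Z_{[-n,-1]}(Q)/n$ a.s. (these limits exist and are constant). (IA): the sequences $\{\zeta_n\}$ and $\{\tau_n\}$ are mutually independent and each consists of i.i.d. random variables. *)

theory Defs
  imports "HOL-Probability.Probability"
begin

section \<open>Daters of a network\<close>

text \<open>
  The functional \<open>f l\<close> takes the \<open>l\<close> arrival epochs and the \<open>l\<close> marks as two families indexed
  by \<open>{..<l}\<close>.  Outside this index set the families are \<open>undefined\<close>, so that they are points of
  the product spaces \<open>PiM {..<l} _\<close> on which \<open>f l\<close> is assumed measurable.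
\<close>

type_synonym 'k functional = "nat \<Rightarrow> (nat \<Rightarrow> real) \<times> (nat \<Rightarrow> 'k) \<Rightarrow> real"

text \<open>\<open>X\<^bsub>[m,n]\<^esub>(T)\<close> for the marks \<open>z\<close>; meaningful for \<open>m \<le> n\<close>.\<close>

definition dater :: "'k functional \<Rightarrow> (int \<Rightarrow> 'k) \<Rightarrow> int \<Rightarrow> int \<Rightarrow> (int \<Rightarrow> real) \<Rightarrow> real" where
  "dater f z m n T =
     (let l = nat (n - m + 1)
      in f l (\<lambda>i\<in>{..<l}. T (m + int i), \<lambda>i\<in>{..<l}. z (m + int i)))"

text \<open>\<open>Z\<^bsub>[m,n]\<^esub>(T)\<close>.\<close>

definition max_dater :: "'k functional \<Rightarrow> (int \<Rightarrow> 'k) \<Rightarrow> int \<Rightarrow> int \<Rightarrow> (int \<Rightarrow> real) \<Rightarrow> real" where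
  "max_dater f z m n T = dater f z m n T - T n"

definition monotone_separable :: "'k functional \<Rightarrow> (int \<Rightarrow> 'k) \<Rightarrow> bool" where
  "monotone_separable f z \<longleftrightarrow>
     \<comment> \<open>causality\<close>
     (\<forall>T m n. mono T \<longrightarrow> m \<le> n \<longrightarrow> T n \<le> dater f z m n T) \<and>
     \<comment> \<open>external monotonicity\<close>
     (\<forall>T T' m n. mono T \<longrightarrow> mono T' \<longrightarrow> m \<le> n \<longrightarrow> (\<forall>k. T k \<le> T' k) \<longrightarrow>
        dater f z m n T \<le> dater f z m n T') \<and>
     \<comment> \<open>homogeneity\<close>
     (\<forall>T c m n. mono T \<longrightarrow> m \<le> n \<longrightarrow>
        dater f z m n (\<lambda>k. c + T k) = dater f z m n T + c) \<and>
     \<comment> \<open>separability\<close>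
     (\<forall>T m l n. mono T \<longrightarrow> m \<le> l \<longrightarrow> l < n \<longrightarrow> dater f z m l T \<le> T (l + 1) \<longrightarrow>
        dater f z m n T = dater f z (l + 1) n T)"

text \<open>
  \<open>Z\<^bsub>(-\<infinity>,0]\<^esub>\<close>, possibly infinite.  By causality maximal daters are nonnegative, so
  \<open>ennreal\<close> truncates nothing.
\<close>

definition stationary_max_dater ::
  "'k functional \<Rightarrow> (int \<Rightarrow> 'k) \<Rightarrow> (int \<Rightarrow> real) \<Rightarrow> ennreal" where
  "stationary_max_dater f z T = lim (\<lambda>n. ennreal (max_dater f z (- int n) 0 T))"

text \<open>Real powers in \<open>[0,\<infinity>]\<close>, for exponents \<open>p > 0\<close> only.\<close>

definition ennreal_powr :: "ennreal \<Rightarrow> real \<Rightarrow> ennreal" where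
  "ennreal_powr x p = (if x = \<infinity> then \<infinity> else ennreal (enn2real x powr p))"

section \<open>Stochastic framework\<close>

text \<open>\<open>T n \<omega>\<close> and \<open>\<zeta> n \<omega>\<close> are the \<open>n\<close>-th arrival epoch and the \<open>n\<close>-th mark.\<close>

definition interarrival :: "(int \<Rightarrow> 'a \<Rightarrow> real) \<Rightarrow> int \<Rightarrow> 'a \<Rightarrow> real" where
  "interarrival T n \<omega> = T (n + 1) \<omega> - T n \<omega>"

definition path_law :: "'a measure \<Rightarrow> 'b measure \<Rightarrow> (int \<Rightarrow> 'a \<Rightarrow> 'b) \<Rightarrow> (int \<Rightarrow> 'b) measure" where
  "path_law M S X = distr M (PiM UNIV (\<lambda>_. S)) (\<lambda>\<omega> n. X n \<omega>)"

definition shift :: "(int \<Rightarrow> 'b) \<Rightarrow> int \<Rightarrow> 'b" where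
  "shift x n = x (n + 1)"

definition stationary_seq :: "'a measure \<Rightarrow> 'b measure \<Rightarrow> (int \<Rightarrow> 'a \<Rightarrow> 'b) \<Rightarrow> bool" where
  "stationary_seq M S X \<longleftrightarrow> path_law M S (\<lambda>n. X (n + 1)) = path_law M S X"

definition ergodic_seq :: "'a measure \<Rightarrow> 'b measure \<Rightarrow> (int \<Rightarrow> 'a \<Rightarrow> 'b) \<Rightarrow> bool" where
  "ergodic_seq M S X \<longleftrightarrow>
     (\<forall>A \<in> sets (path_law M S X). shift -` A \<inter> space (path_law M S X) = A \<longrightarrow>
        measure (path_law M S X) A \<in> {0, 1})"

text \<open>
  The axioms of a monotone-separable network quantify over the deterministic inputs \<open>T\<close>; the marks
  are those of the realisation \<open>\<omega>\<close>.  The arrival rate is positive since it is the inverse of a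
  finite mean.
\<close>

locale monotone_separable_network = prob_space M
  for M :: "'a measure" and K :: "'k measure" and f :: "'k functional"
    and T :: "int \<Rightarrow> 'a \<Rightarrow> real" and \<zeta> :: "int \<Rightarrow> 'a \<Rightarrow> 'k" and rate :: real +
  assumes functional_measurable:
      "\<And>l. l \<ge> 1 \<Longrightarrow> f l \<in> borel_measurable (PiM {..<l} (\<lambda>_. borel) \<Otimes>\<^sub>M PiM {..<l} (\<lambda>_. K))"
    and epoch_measurable: "\<And>n. T n \<in> borel_measurable M"
    and mark_measurable: "\<And>n. \<zeta> n \<in> measurable M K"
    and epochs_mono: "\<And>\<omega>. \<omega> \<in> space M \<Longrightarrow> mono (\<lambda>n. T n \<omega>)"
    and separable: "\<And>\<omega>. \<omega> \<in> space M \<Longrightarrow> monotone_separable f (\<lambda>n. \<zeta> n \<omega>)"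
    and stationary: "stationary_seq M (borel \<Otimes>\<^sub>M K) (\<lambda>n \<omega>. (interarrival T n \<omega>, \<zeta> n \<omega>))"
    and ergodic: "ergodic_seq M (borel \<Otimes>\<^sub>M K) (\<lambda>n \<omega>. (interarrival T n \<omega>, \<zeta> n \<omega>))"
    and rate_pos: "rate > 0"
    and interarrival_integrable: "\<And>n. integrable M (interarrival T n)"
    and interarrival_mean: "\<And>n. expectation (interarrival T n) = inverse rate"
    and max_dater_integrable:
      "\<And>n. integrable M (\<lambda>\<omega>. max_dater f (\<lambda>k. \<zeta> k \<omega>) n n (\<lambda>k. T k \<omega>))"

text \<open>
  \<open>\<gamma>(0) = lim\<^sub>n E Z\<^bsub>[-n,-1]\<^esub>(Q) / n\<close>, with \<open>Q\<close> the input all of whose points are \<open>0\<close>.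
  The index \<open>n = 0\<close> is irrelevant to the limit.
\<close>

definition gamma0 :: "'a measure \<Rightarrow> 'k functional \<Rightarrow> (int \<Rightarrow> 'a \<Rightarrow> 'k) \<Rightarrow> real" where
  "gamma0 M f \<zeta> =
     lim (\<lambda>n. (\<integral>\<omega>. max_dater f (\<lambda>k. \<zeta> k \<omega>) (- int n) (- 1) (\<lambda>_. 0) \<partial>M) / real n)"

definition iid_seq :: "'a measure \<Rightarrow> 'b measure \<Rightarrow> (int \<Rightarrow> 'a \<Rightarrow> 'b) \<Rightarrow> bool" where
  "iid_seq M S X \<longleftrightarrow>
     prob_space.indep_vars M (\<lambda>_. S) X UNIV \<and> (\<forall>n. distr M S (X n) = distr M S (X 0))"

text \<open>
  Independence of the two sequences is stated for the sigma-algebras they generate, because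
  \<^const>\<open>prob_space.indep_var\<close> relates only variables of the same type.
\<close>

definition indep_seqs ::
  "'a measure \<Rightarrow> 'b measure \<Rightarrow> (int \<Rightarrow> 'a \<Rightarrow> 'b) \<Rightarrow> 'c measure \<Rightarrow> (int \<Rightarrow> 'a \<Rightarrow> 'c) \<Rightarrow> bool" where
  "indep_seqs M S X S' Y \<longleftrightarrow>
     prob_space.indep_set M
       (sets (vimage_algebra (space M) (\<lambda>\<omega> n. X n \<omega>) (PiM UNIV (\<lambda>_. S))))
       (sets (vimage_algebra (space M) (\<lambda>\<omega> n. Y n \<omega>) (PiM UNIV (\<lambda>_. S'))))"

definition IA ::
  "'a measure \<Rightarrow> 'k measure \<Rightarrow> (int \<Rightarrow> 'a \<Rightarrow> real) \<Rightarrow> (int \<Rightarrow> 'a \<Rightarrow> 'k) \<Rightarrow> bool" where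
  "IA M K T \<zeta> \<longleftrightarrow>
     indep_seqs M K \<zeta> borel (interarrival T) \<and>
     iid_seq M K \<zeta> \<and> iid_seq M borel (interarrival T)"

end

theory Submission
  imports Defs "HOL-Real_Asymp.Real_Asymp"
begin

text \<open>
  Group the customers into blocks of fixed length \<open>L\<close>.  Delaying every customer of a block until the
  whole block has arrived and the network is empty dominates the maximal daters by a single server
  queue: \<open>Z\<^bsub>[0,(k+1)L]\<^esub> \<le> s\<^sub>k + (Z\<^bsub>[0,kL]\<^esub> - t\<^sub>k)\<^sup>+\<close>, where \<open>s\<^sub>k\<close> is the maximal dater of the
  \<open>k\<close>-th block for the input \<open>Q\<close> and \<open>t\<^sub>k\<close> the time the block takes to arrive.  By
  subadditivity \<open>E s\<^sub>k < E t\<^sub>k\<close> for a suitable \<open>L\<close>, and \<open>(s\<^sub>k, t\<^sub>k)\<close> is independent of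
  \<open>Z\<^bsub>[0,kL]\<^esub>\<close>.  Hence \<open>v\<^sub>k = E Z\<^bsub>[0,kL]\<^esub> powr \<alpha>\<close> and \<open>a\<^sub>k = E Z\<^bsub>[0,kL]\<^esub> powr (\<alpha> - 1)\<close> satisfy
  \<open>v\<^bsub>k+1\<^esub> + c a\<^sub>k \<le> v\<^sub>k + C\<close> with \<open>c > 0\<close>.  Summation bounds the averages of \<open>a\<^sub>k\<close>; as
  \<open>a\<^sub>k = E Z\<^bsub>[-kL,0]\<^esub> powr (\<alpha> - 1)\<close> is nondecreasing, it is bounded, and monotone convergence
  concludes.
\<close>

section \<open>Deterministic properties of maximal daters\<close>

lemma dater_cong:
  assumes "\<And>k. m \<le> k \<Longrightarrow> k \<le> n \<Longrightarrow> T k = T' k"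
  shows "dater f z m n T = dater f z m n T'"
proof -
  have "(\<lambda>i\<in>{..<nat (n - m + 1)}. T (m + int i)) = (\<lambda>i\<in>{..<nat (n - m + 1)}. T' (m + int i))"
    by (intro restrict_ext assms) (auto simp: lessThan_iff)
  then show ?thesis
    by (simp add: dater_def Let_def)
qed

context
  fixes f :: "'k functional" and z :: "int \<Rightarrow> 'k"
  assumes separable: "monotone_separable f z"
begin

lemma dater_causal: "mono T \<Longrightarrow> m \<le> n \<Longrightarrow> T n \<le> dater f z m n T"
  and dater_mono:
    "mono T \<Longrightarrow> mono T' \<Longrightarrow> m \<le> n \<Longrightarrow> (\<And>k. T k \<le> T' k) \<Longrightarrow> dater f z m n T \<le> dater f z m n T'"
  and dater_add: "mono T \<Longrightarrow> m \<le> n \<Longrightarrow> dater f z m n (\<lambda>k. c + T k) = dater f z m n T + c"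
  and dater_separable:
    "mono T \<Longrightarrow> m \<le> l \<Longrightarrow> l < n \<Longrightarrow> dater f z m l T \<le> T (l + 1) \<Longrightarrow>
      dater f z m n T = dater f z (l + 1) n T"
  using separable unfolding monotone_separable_def by blast+

lemma max_dater_nonneg: "mono T \<Longrightarrow> m \<le> n \<Longrightarrow> 0 \<le> max_dater f z m n T"
  using dater_causal[of T m n] by (simp add: max_dater_def)

lemma max_dater_add: "mono T \<Longrightarrow> m \<le> n \<Longrightarrow> max_dater f z m n (\<lambda>k. c + T k) = max_dater f z m n T"
  by (simp add: max_dater_def dater_add)

text \<open>With a single customer only the epoch \<open>T n\<close> enters, so the input may be
  taken constant, and homogeneity removes the constant.\<close>

lemma max_dater_single: "max_dater f z n n T = max_dater f z n n (\<lambda>_. 0)"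
proof -
  have "dater f z n n T = dater f z n n (\<lambda>_. T n + 0)"
    by (rule dater_cong) auto
  also have "\<dots> = dater f z n n (\<lambda>_. 0) + T n"
    by (rule dater_add) (auto intro: monoI)
  finally show ?thesis
    by (simp add: max_dater_def)
qed

text \<open>
  Customers \<open>l + 1, \<dots>, n\<close> are all delayed until customer \<open>n\<close> has arrived and the network
  has emptied of customers \<open>m, \<dots>, l\<close>.
\<close>

lemma max_dater_recursion:
  assumes T: "mono T" and "m \<le> l" "l < n"
  shows "max_dater f z m n T
    \<le> max_dater f z (l + 1) n (\<lambda>_. 0) + max 0 (max_dater f z m l T - (T n - T l))"
proof -
  define c where "c = max (dater f z m l T) (T n)"
  \<comment> \<open>\<open>T'\<close> equals \<open>c\<close> beyond customer \<open>n\<close> as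
    well, where \<open>T\<close> may exceed \<open>c\<close>. Freezing \<open>T\<close> at
    \<open>T n\<close> gives \<open>T0 k <= T' k\<close> for all \<open>k\<close>, as external
    monotonicity demands, and leaves the dater up to \<open>n\<close> unchanged.\<close>
  define T0 where "T0 k = T (min k n)" for k
  define T' where "T' k = (if k \<le> l then T k else c)" for k
  have "mono T0"
    unfolding T0_def by (intro monoI monoD[OF T]) auto
  have "T k \<le> c" if "k \<le> n" for k
    using monoD[OF T that] by (simp add: c_def)
  then have "mono T'" and le: "T0 k \<le> T' k" for k
    using \<open>l < n\<close> by (auto simp: T'_def T0_def intro!: monoI monoD[OF T])
  have *: "dater f z m l T' = dater f z m l T"
    by (rule dater_cong) (auto simp: T'_def)
  have "dater f z m n T = dater f z m n T0"
    by (rule dater_cong) (auto simp: T0_def)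
  also have "\<dots> \<le> dater f z m n T'"
    using \<open>mono T0\<close> \<open>mono T'\<close> assms le by (intro dater_mono) auto
  \<comment> \<open>Customers \<open>m, ..., l\<close> are gone by time
    \<open>c = T' (l + 1)\<close>, so separability forgets them.\<close>
  also have "\<dots> = dater f z (l + 1) n T'"
    using \<open>mono T'\<close> assms * by (intro dater_separable) (auto simp: T'_def c_def)
  also have "\<dots> = dater f z (l + 1) n (\<lambda>_. c + 0)"
    by (rule dater_cong) (auto simp: T'_def)
  also have "\<dots> = dater f z (l + 1) n (\<lambda>_. 0) + c"
    using \<open>l < n\<close> by (intro dater_add) (auto intro: monoI)
  finally show ?thesis
    by (auto simp: max_dater_def c_def)
qed

text \<open>For the zero input no time passes between customers \<open>l\<close> and
  \<open>n\<close>, and the positive part of a nonnegative dater is the dater itself, so the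
  recursion becomes subadditivity.\<close>

lemma max_dater_zero_subadditive:
  assumes "m \<le> l" "l < n"
  shows "max_dater f z m n (\<lambda>_. 0)
    \<le> max_dater f z m l (\<lambda>_. 0) + max_dater f z (l + 1) n (\<lambda>_. 0)"
proof -
  have "mono (\<lambda>_::int. 0::real)"
    by (rule monoI) simp
  then show ?thesis
    using max_dater_recursion[of "\<lambda>_. 0", OF _ assms] max_dater_nonneg[of "\<lambda>_. 0", OF _ assms(1)]
    by simp
qed

text \<open>Customer \<open>m\<close> is moved so early that it leaves before customer \<open>m + 1\<close> arrives.\<close>

lemma max_dater_Suc_le:
  assumes T: "mono T" and "m < n"
  shows "max_dater f z (m + 1) n T \<le> max_dater f z m n T"
proof -
  define c where "c = max_dater f z m m T"
  define T' where "T' k = (if k \<le> m then - c + T k else T k)" for k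
  have "0 \<le> c"
    unfolding c_def by (rule max_dater_nonneg[OF T]) simp
  then have "mono T'"
    using monoD[OF T] by (fastforce simp: T'_def intro!: monoI)
  \<comment> \<open>Advancing customer \<open>m\<close> by its own maximal dater makes it finish
    exactly at \<open>T m\<close>, hence before the next epoch, as separability demands.\<close>
  have "dater f z m m T' = dater f z m m (\<lambda>k. - c + T k)"
    by (rule dater_cong) (auto simp: T'_def)
  also have "\<dots> = T m"
    by (subst dater_add[OF T]) (simp_all add: c_def max_dater_def)
  also have "\<dots> \<le> T' (m + 1)"
    using monoD[OF T] by (simp add: T'_def)
  finally have "dater f z m n T' = dater f z (m + 1) n T'"
    using \<open>mono T'\<close> \<open>m < n\<close> by (intro dater_separable) auto
  also have "\<dots> = dater f z (m + 1) n T"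
    by (rule dater_cong) (auto simp: T'_def)
  finally have "dater f z (m + 1) n T = dater f z m n T'" ..
  also have "\<dots> \<le> dater f z m n T"
    using \<open>mono T'\<close> \<open>0 \<le> c\<close> assms by (intro dater_mono) (auto simp: T'_def)
  finally show ?thesis
    by (simp add: max_dater_def)
qed

lemma incseq_max_dater:
  assumes T: "mono T"
  shows "incseq (\<lambda>n. max_dater f z (- int n) 0 T)"
proof (rule incseq_SucI)
  fix n
  show "max_dater f z (- int n) 0 T \<le> max_dater f z (- int (Suc n)) 0 T"
    using max_dater_Suc_le[OF T, of "- int (Suc n)" 0] by simp
qed

end

section \<open>Drift and moment bounds\<close>

text \<open>Fekete's lemma. It turns the limit that defines \<open>gamma0\<close> into an infimum,
  so that a bound on the limit already holds at one finite index.\<close>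

lemma subadditive_convergent:
  fixes a :: "nat \<Rightarrow> real"
  assumes sub: "\<And>m n. a (m + n) \<le> a m + a n" and nonneg: "\<And>n. 0 \<le> a n"
  shows "(\<lambda>n. a n / real n) \<longlonglongrightarrow> (INF n\<in>{1..}. a n / real n)"
    (is "_ \<longlonglongrightarrow> ?I")
proof -
  have bdd: "bdd_below ((\<lambda>n. a n / real n) ` {1..})"
    using nonneg by (intro bdd_belowI[of _ 0]) auto
  have le_mult: "a (q * m) \<le> real q * a m" if "0 < q" for q m
    using that
  proof (induction q rule: nat_induct_non_zero)
    case (Suc q)
    then show ?case using sub[of m "q * m"] by (simp add: algebra_simps)
  qed simp
  \<comment> \<open>Divide \<open>n\<close> by \<open>m\<close> with remainder. The remainder costs
    at most the sum of all \<open>a r\<close> with \<open>r < m\<close>, which is free of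
    \<open>n\<close> and vanishes after division by \<open>n\<close>.\<close>
  have le_div: "a n / real n \<le> a m / real m + (\<Sum>r<m. a r) / real n" if "1 \<le> m" "m \<le> n" for m n
  proof -
    have "a n = a ((n div m) * m + n mod m)"
      by simp
    also have "\<dots> \<le> a ((n div m) * m) + a (n mod m)"
      by (rule sub)
    also have "a ((n div m) * m) \<le> real (n div m) * a m"
      using that by (intro le_mult) (simp add: div_greater_zero_iff)
    also have "a (n mod m) \<le> (\<Sum>r<m. a r)"
      using that nonneg by (intro member_le_sum) auto
    also have "real (n div m) * a m \<le> real n / real m * a m"
      using nonneg div_times_less_eq_dividend[of n m] that
      by (intro mult_right_mono) (simp_all add: field_simps flip: of_nat_mult)
    finally show ?thesis
      using that by (simp add: field_simps)
  qed
  show ?thesis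
  proof (rule LIMSEQ_I)
    fix e :: real assume "0 < e"
    obtain m where m: "1 \<le> m" "a m / real m < ?I + e / 2"
      using cINF_less_iff[of "{1..}" "\<lambda>n. a n / real n" "?I + e / 2"] bdd \<open>0 < e\<close> by auto
    have "(\<lambda>n. (\<Sum>r<m. a r) / real n) \<longlonglongrightarrow> 0"
      by (rule lim_const_over_n)
    then have "\<forall>\<^sub>F n in sequentially. (\<Sum>r<m. a r) / real n < e / 2"
      using \<open>0 < e\<close> by (intro order_tendstoD) auto
    then obtain N where N: "\<And>n. n \<ge> N \<Longrightarrow> (\<Sum>r<m. a r) / real n < e / 2"
      by (auto simp: eventually_sequentially)
    have "norm (a n / real n - ?I) < e" if "max N m \<le> n" for n
    proof -
      have "m \<le> n" "N \<le> n"
        using that by auto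
      moreover have "?I \<le> a n / real n"
        using that m by (intro cINF_lower bdd) auto
      ultimately show ?thesis
        unfolding real_norm_def using le_div[of m n] N[of n] m by linarith
    qed
    then show "\<exists>N. \<forall>n\<ge>N. norm (a n / real n - ?I) < e"
      by blast
  qed
qed

text \<open>Mean value theorem: the derivative \<open>a * x powr (a - 1)\<close> is nondecreasing
  because \<open>1 <= a\<close>, so its value at \<open>w\<close> dominates. The endpoint
  \<open>v = 0\<close> is treated directly, since differentiating \<open>powr\<close> asks for a
  positive argument.\<close>

lemma powr_diff_le:
  fixes v w a :: real
  assumes "0 \<le> v" "v \<le> w" "1 \<le> a"
  shows "w powr a - v powr a \<le> a * (w - v) * w powr (a - 1)"
proof (cases "v = 0")
  case True
  show ?thesis
  proof (cases "w = 0")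
    case False
    then have "w powr a = w * w powr (a - 1)"
      using assms by (simp add: powr_mult_base)
    also have "\<dots> \<le> a * (w * w powr (a - 1))"
      using assms by (intro mult_right_mono[of 1 a, simplified]) auto
    finally show ?thesis using True by simp
  qed (use True in simp)
next
  case False
  show ?thesis
  proof (cases "v = w")
    case neq: False
    with False assms have "0 < v" "v < w" by auto
    have "\<exists>x>v. x < w \<and> w powr a - v powr a = (w - v) * (a * x powr (a - 1))"
      using \<open>0 < v\<close> \<open>v < w\<close>
      by (intro MVT2) (auto intro!: derivative_eq_intros simp: field_simps powr_diff)
    then obtain x where x: "v < x" "x < w" "w powr a - v powr a = (w - v) * (a * x powr (a - 1))"
      by blast
    have "x powr (a - 1) \<le> w powr (a - 1)"
      using x \<open>0 < v\<close> assms by (intro powr_mono2) auto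
    then show ?thesis
      using x assms by (simp add: mult_left_mono mult.assoc mult.left_commute)
  qed simp
qed

text \<open>First-order expansion of the power at infinity. It supplies the pointwise limit of the
  normalised increments in \<open>queue_drift\<close>.\<close>

lemma powr_increment_tendsto:
  fixes x a :: real
  shows "((\<lambda>u. ((u + x) powr a - u powr a) / u powr (a - 1)) \<longlongrightarrow> a * x) at_top"
proof (cases "x = 0 \<or> a = 0")
  case False
  then have "x < 0 \<or> x > 0" "a < 0 \<or> a > 0" by auto
  then show ?thesis
   by (elim disjE) real_asymp+
qed (auto intro!: tendsto_eventually eventually_mono[OF eventually_gt_at_top[of "max 0 (-x)"]])

text \<open>The bounds \<open>x + y <= 2 * max x y\<close> and
  \<open>max x y powr a <= x powr a + y powr a\<close> cover exponents below \<open>1\<close> and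
  above \<open>1\<close> alike.\<close>

lemma (in prob_space) powr_sum_integrable:
  fixes X Y :: "'a \<Rightarrow> real"
  assumes [measurable]: "X \<in> borel_measurable M" "Y \<in> borel_measurable M"
    and nonneg: "\<And>\<omega>. \<omega> \<in> space M \<Longrightarrow> 0 \<le> X \<omega>" "\<And>\<omega>. \<omega> \<in> space M \<Longrightarrow> 0 \<le> Y \<omega>"
    and int: "integrable M (\<lambda>\<omega>. X \<omega> powr a)" "integrable M (\<lambda>\<omega>. Y \<omega> powr a)"
    and "0 < a"
  shows "integrable M (\<lambda>\<omega>. (X \<omega> + Y \<omega>) powr a)"
proof (rule Bochner_Integration.integrable_bound)
  show "integrable M (\<lambda>\<omega>. 2 powr a * (X \<omega> powr a + Y \<omega> powr a))"
    using int by auto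
  show "AE \<omega> in M. norm ((X \<omega> + Y \<omega>) powr a) \<le> norm (2 powr a * (X \<omega> powr a + Y \<omega> powr a))"
  proof (rule AE_I2)
    fix \<omega> assume "\<omega> \<in> space M"
    define x y where "x = X \<omega>" and "y = Y \<omega>"
    have "0 \<le> x" "0 \<le> y"
      using nonneg \<open>\<omega> \<in> space M\<close> by (auto simp: x_def y_def)
    then have "(x + y) powr a \<le> (2 * max x y) powr a"
      using \<open>0 < a\<close> by (intro powr_mono2) auto
    also have "\<dots> = 2 powr a * max x y powr a"
      using \<open>0 \<le> x\<close> by (simp add: powr_mult)
    also have "max x y powr a \<le> x powr a + y powr a"
      by (simp add: max_def)
    finally show "norm ((X \<omega> + Y \<omega>) powr a) \<le> norm (2 powr a * (X \<omega> powr a + Y \<omega> powr a))"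
      by (simp add: x_def y_def)
  qed
qed simp

text \<open>Summing the drift inequality telescopes \<open>V\<close> and bounds the averages of
  \<open>A\<close>. Monotonicity turns this into a pointwise bound, since \<open>A k\<close> is
  below the average over \<open>{k..2 * k}\<close>. Everything is added and nothing subtracted,
  because the values lie in \<open>ennreal\<close>.\<close>

lemma ennreal_drift_bound:
  fixes V A :: "nat \<Rightarrow> ennreal" and c C :: real
  assumes step: "\<And>k. V (Suc k) + ennreal c * A k \<le> V k + ennreal C"
    and mono: "incseq A" and start: "V 0 < \<infinity>" and "0 < c" "0 \<le> C"
  obtains B where "B < \<infinity>" "\<And>k. A k \<le> B"
proof
  have sum: "V n + ennreal c * (\<Sum>j<n. A j) \<le> V 0 + of_nat n * ennreal C" for n
  proof (induction n)
    case (Suc n)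
    have "V (Suc n) + ennreal c * (\<Sum>j<Suc n. A j)
        = (V (Suc n) + ennreal c * A n) + ennreal c * (\<Sum>j<n. A j)"
      by (simp add: distrib_left ac_simps)
    also have "\<dots> \<le> (V n + ennreal C) + ennreal c * (\<Sum>j<n. A j)"
      by (intro add_right_mono step)
    also have "\<dots> = (V n + ennreal c * (\<Sum>j<n. A j)) + ennreal C"
      by (simp add: ac_simps)
    also have "\<dots> \<le> (V 0 + of_nat n * ennreal C) + ennreal C"
      by (intro add_right_mono Suc)
    finally show ?case
      by (simp add: algebra_simps)
  qed simp
  \<comment> \<open>Each of the \<open>Suc k\<close> indices in \<open>{k..2 * k}\<close>
    contributes at least \<open>A k\<close>, while the whole sum is bounded by
    \<open>V 0 + (2 * k + 1) * C <= Suc k * (V 0 + 2 * C)\<close>. Cancelling \<open>Suc k\<close>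
    and dividing by \<open>c\<close> leaves this value.\<close>
  let ?B = "(V 0 + 2 * ennreal C) / ennreal c"
  show "?B < \<infinity>"
    using start \<open>0 < c\<close>
    by (auto simp: ennreal_divide_eq_top_iff less_top[symmetric] ennreal_mult_eq_top_iff)
  show "A k \<le> ?B" for k
  proof -
    have "of_nat (Suc k) * A k = (\<Sum>j=k..<Suc (2 * k). A k)"
      by simp
    also have "\<dots> \<le> (\<Sum>j=k..<Suc (2 * k). A j)"
      using mono by (intro sum_mono) (auto simp: incseq_def)
    also have "\<dots> \<le> (\<Sum>j<Suc (2 * k). A j)"
      by (intro sum_mono2) auto
    finally have "ennreal c * (of_nat (Suc k) * A k) \<le> ennreal c * (\<Sum>j<Suc (2 * k). A j)"
      by (intro mult_left_mono) auto
    also have "\<dots> \<le> V (Suc (2 * k)) + ennreal c * (\<Sum>j<Suc (2 * k). A j)"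
      by simp
    also have "\<dots> \<le> V 0 + of_nat (Suc (2 * k)) * ennreal C"
      by (rule sum)
    also have "\<dots> \<le> of_nat (Suc k) * V 0 + of_nat (Suc k) * (2 * ennreal C)"
    proof (rule add_mono)
      show "V 0 \<le> of_nat (Suc k) * V 0"
        using mult_right_mono[of 1 "of_nat (Suc k) :: ennreal" "V 0"] by (simp add: add.commute)
      have "of_nat (Suc (2 * k)) * ennreal C \<le> of_nat (Suc k * 2) * ennreal C"
        by (intro mult_right_mono of_nat_mono) auto
      then show "of_nat (Suc (2 * k)) * ennreal C \<le> of_nat (Suc k) * (2 * ennreal C)"
        by (simp only: of_nat_mult mult.assoc of_nat_numeral)
    qed
    finally have "of_nat (Suc k) * (ennreal c * A k) \<le> of_nat (Suc k) * (V 0 + 2 * ennreal C)"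
      by (simp only: distrib_left mult.left_commute)
    then have "ennreal c * A k \<le> V 0 + 2 * ennreal C"
      by (subst (asm) ennreal_mult_le_mult_iff) (auto simp del: of_nat_Suc)
    then have "(ennreal c * A k) / ennreal c \<le> ?B"
      by (rule divide_right_mono_ennreal)
    then show ?thesis
      using \<open>0 < c\<close> by (simp add: ennreal_mult_divide_eq mult.commute)
  qed
qed

text \<open>Carries the power through the limit that defines the stationary maximal dater. For
  bounded \<open>x\<close> the power is continuous at the limit, even if that is \<open>0\<close>,
  because \<open>0 < p\<close>; for unbounded \<open>x\<close> the supremum is infinite.\<close>

lemma ennreal_powr_lim_le:
  fixes x :: "nat \<Rightarrow> real"
  assumes "incseq x" "\<And>n. 0 \<le> x n" "0 < p"
  shows "ennreal_powr (lim (\<lambda>n. ennreal (x n))) p \<le> (SUP n. ennreal (x n powr p))"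
proof (cases "bdd_above (range x)")
  case True
  then obtain s where s: "x \<longlonglongrightarrow> s"
    using \<open>incseq x\<close> LIMSEQ_incseq_SUP by blast
  then have "0 \<le> s"
    using assms(2) by (intro LIMSEQ_le_const) auto
  have "(\<lambda>n. ennreal (x n)) \<longlonglongrightarrow> ennreal s"
    using s by (rule tendsto_ennrealI)
  then have "lim (\<lambda>n. ennreal (x n)) = ennreal s"
    by (rule limI)
  moreover have "(\<lambda>n. ennreal (x n powr p)) \<longlonglongrightarrow> ennreal (s powr p)"
    using assms by (intro tendsto_ennrealI tendsto_powr' s) auto
  then have "ennreal (s powr p) \<le> (SUP n. ennreal (x n powr p))"
    by (rule LIMSEQ_le_const2) (intro exI[of _ 0] allI impI SUP_upper UNIV_I)
  ultimately show ?thesis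
    using \<open>0 \<le> s\<close> by (simp add: ennreal_powr_def)
next
  case False
  have "filterlim x at_top sequentially"
  proof (rule filterlim_at_top[THEN iffD2], rule allI)
    fix Z :: real
    obtain N where "Z < x N"
      using False by (auto simp: bdd_above_def not_le)
    then show "\<forall>\<^sub>F n in sequentially. Z \<le> x n"
      using \<open>incseq x\<close> by (intro eventually_sequentiallyI[of N]) (smt (verit) incseqD)
  qed
  moreover have "filterlim (\<lambda>u. u powr p) at_top at_top"
    using \<open>0 < p\<close> by real_asymp
  ultimately have "filterlim (\<lambda>n. x n powr p) at_top sequentially"
    by (rule filterlim_compose[rotated])
  then have "(\<lambda>n. ennreal (x n powr p)) \<longlonglongrightarrow> \<infinity>"
    by (simp add: ennreal_tendsto_top_eq_at_top)
  then have "\<infinity> \<le> (SUP n. ennreal (x n powr p))"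
    by (rule LIMSEQ_le_const2) (intro exI[of _ 0] allI impI SUP_upper UNIV_I)
  then show ?thesis
    by (rule order_trans[rotated]) simp
qed

text \<open>The joint law of independent variables is a product, so the integral iterates. Pulling
  both marginals back to \<open>M\<close> turns the inner variable into an independent copy over a
  second sample point.\<close>

lemma (in prob_space) nn_integral_indep_var:
  assumes indep: "indep_var A X B Y" and g [measurable]: "g \<in> borel_measurable (A \<Otimes>\<^sub>M B)"
  shows "(\<integral>\<^sup>+\<omega>. g (X \<omega>, Y \<omega>) \<partial>M) = (\<integral>\<^sup>+\<omega>. (\<integral>\<^sup>+\<omega>'. g (X \<omega>, Y \<omega>') \<partial>M) \<partial>M)"
proof -
  have [measurable]: "X \<in> measurable M A" "Y \<in> measurable M B"
    using indep by (auto dest: indep_var_rv1 indep_var_rv2)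
  interpret Y: prob_space "distr M B Y"
    by (rule prob_space_distr) simp
  have "(\<integral>\<^sup>+\<omega>. g (X \<omega>, Y \<omega>) \<partial>M) = (\<integral>\<^sup>+p. g p \<partial>distr M (A \<Otimes>\<^sub>M B) (\<lambda>\<omega>. (X \<omega>, Y \<omega>)))"
    by (simp add: nn_integral_distr)
  also have "\<dots> = (\<integral>\<^sup>+p. g p \<partial>(distr M A X \<Otimes>\<^sub>M distr M B Y))"
    using indep by (simp add: indep_var_distribution_eq)
  also have "\<dots> = (\<integral>\<^sup>+x. \<integral>\<^sup>+y. g (x, y) \<partial>distr M B Y \<partial>distr M A X)"
    by (rule Y.nn_integral_fst[symmetric]) simp
  also have "\<dots> = (\<integral>\<^sup>+\<omega>. \<integral>\<^sup>+y. g (X \<omega>, y) \<partial>distr M B Y \<partial>M)"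
    by (intro nn_integral_distr Y.borel_measurable_nn_integral) simp_all
  also have "\<dots> = (\<integral>\<^sup>+\<omega>. (\<integral>\<^sup>+\<omega>'. g (X \<omega>, Y \<omega>') \<partial>M) \<partial>M)"
  proof (rule nn_integral_cong)
    fix \<omega> assume "\<omega> \<in> space M"
    then have [measurable]: "X \<omega> \<in> space A"
      by (simp add: measurable_space[of X M A])
    show "(\<integral>\<^sup>+y. g (X \<omega>, y) \<partial>distr M B Y) = (\<integral>\<^sup>+\<omega>'. g (X \<omega>, Y \<omega>') \<partial>M)"
      by (rule nn_integral_distr) simp_all
  qed
  finally show ?thesis .
qed

text \<open>Lyapunov drift of \<open>u powr a\<close> under one step of a single server queue. The
  increment divided by \<open>u powr (a - 1)\<close> tends to \<open>a * (S - D)\<close> and is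
  dominated, so its mean has a negative limit; this settles large \<open>u\<close>, and
  \<open>C\<close> absorbs the small ones.\<close>

lemma (in prob_space) queue_drift:
  fixes S D :: "'a \<Rightarrow> real"
  assumes [measurable]: "S \<in> borel_measurable M"
    and nonneg: "\<And>\<omega>. \<omega> \<in> space M \<Longrightarrow> 0 \<le> S \<omega>" "\<And>\<omega>. \<omega> \<in> space M \<Longrightarrow> 0 \<le> D \<omega>"
    and int_S: "integrable M S" and int_D: "integrable M D"
    and int_powr: "integrable M (\<lambda>\<omega>. S \<omega> powr a)"
    and "1 < a" and drift: "expectation S < expectation D"
  obtains c C where "0 < c" "0 \<le> C"
    "\<And>u. 0 \<le> u \<Longrightarrow> (\<integral>\<^sup>+\<omega>. ennreal ((S \<omega> + max 0 (u - D \<omega>)) powr a) \<partial>M)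
      + ennreal (c * u powr (a - 1)) \<le> ennreal (u powr a + C)"
proof -
  note [measurable] = borel_measurable_integrable[OF int_D]
  define h where "h u \<omega> = (S \<omega> + max 0 (u - D \<omega>)) powr a" for u \<omega>
  define g where "g u \<omega> = (h u \<omega> - u powr a) / u powr (a - 1)" for u \<omega>
  \<comment> \<open>Dominates \<open>g u\<close> for all \<open>u >= 1\<close>:
    \<open>(1 + S) powr a\<close> controls the increases and \<open>D\<close> the decreases.\<close>
  define w where "w \<omega> = a * (D \<omega> + (1 + S \<omega>) powr a)" for \<omega>
  have [measurable]: "h u \<in> borel_measurable M" "g u \<in> borel_measurable M" for u
    by (simp_all add: h_def[abs_def] g_def[abs_def])
  have int_add: "integrable M (\<lambda>\<omega>. (u + S \<omega>) powr a)" if "0 \<le> u" for u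
    using that \<open>1 < a\<close> by (intro powr_sum_integrable nonneg int_powr) auto
  have bound: "norm (g u \<omega>) \<le> w \<omega>" if "1 \<le> u" "\<omega> \<in> space M" for u \<omega>
  proof -
    define s d v where "s = S \<omega>" and "d = D \<omega>" and "v = max 0 (u - D \<omega>)"
    have sd: "0 \<le> s" "0 \<le> d" "0 \<le> v" "v \<le> u" "u - v \<le> d"
      using nonneg[OF \<open>\<omega> \<in> space M\<close>] \<open>1 \<le> u\<close> by (auto simp: s_def d_def v_def)
    have hv: "h u \<omega> = (s + v) powr a"
      by (simp add: h_def s_def v_def)
    have "(s + v) powr a - u powr a \<le> (s + u) powr a - u powr a"
      using sd \<open>1 < a\<close> by (auto intro!: powr_mono2)
    also have "\<dots> \<le> a * s * (s + u) powr (a - 1)"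
      using powr_diff_le[of u "s + u" a] sd \<open>1 < a\<close> \<open>1 \<le> u\<close> by simp
    \<comment> \<open>From \<open>1 <= u\<close> follows \<open>s + u <= (1 + s) * u\<close>, which
      splits off \<open>u powr (a - 1)\<close>; enlarging \<open>s\<close> to \<open>1 + s\<close>
      merges the remaining factors into one power.\<close>
    also have "\<dots> \<le> a * (1 + s) * ((1 + s) * u) powr (a - 1)"
      using sd \<open>1 < a\<close> \<open>1 \<le> u\<close> mult_left_mono[OF \<open>1 \<le> u\<close> \<open>0 \<le> s\<close>]
      by (intro mult_mono powr_mono2) (auto simp: algebra_simps)
    also have "\<dots> = a * (1 + s) powr a * u powr (a - 1)"
      using sd \<open>1 \<le> u\<close> powr_mult_base[of "1 + s" "a - 1"] by (simp add: powr_mult)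
    finally have up: "h u \<omega> - u powr a \<le> a * (1 + s) powr a * u powr (a - 1)"
      by (simp add: hv)
    have "u powr a - (s + v) powr a \<le> u powr a - v powr a"
      using sd \<open>1 < a\<close> by (auto intro!: powr_mono2)
    also have "\<dots> \<le> a * (u - v) * u powr (a - 1)"
      using sd \<open>1 < a\<close> by (intro powr_diff_le) auto
    also have "\<dots> \<le> a * d * u powr (a - 1)"
      using sd \<open>1 < a\<close> by (intro mult_right_mono mult_left_mono) auto
    finally have low: "u powr a - h u \<omega> \<le> a * d * u powr (a - 1)"
      by (simp add: hv)
    have "0 < u powr (a - 1)"
      using \<open>1 \<le> u\<close> by simp
    then have "g u \<omega> \<le> a * (1 + s) powr a" "- g u \<omega> \<le> a * d"
      using up low by (simp_all add: g_def pos_divide_le_eq minus_divide_left del: minus_divide_left[symmetric])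
    moreover have "0 \<le> a * (1 + s) powr a" "0 \<le> a * d"
      using sd \<open>1 < a\<close> by auto
    ultimately show ?thesis
      by (simp add: w_def s_def d_def distrib_left abs_le_iff)
  qed
  have int_w: "integrable M w"
    unfolding w_def by (intro integrable_mult_right Bochner_Integration.integrable_add int_D int_add) simp
  have int_g: "integrable M (g u)" if "1 \<le> u" for u
    by (rule Bochner_Integration.integrable_bound[OF int_w]) (use bound[OF that] in \<open>auto intro!: AE_I2 order_trans[OF _ abs_ge_self]\<close>)
  have "((\<lambda>u. \<integral>\<omega>. g u \<omega> \<partial>M) \<longlongrightarrow> (\<integral>\<omega>. a * (S \<omega> - D \<omega>) \<partial>M)) at_top"
  proof (rule integral_dominated_convergence_at_top[where w = w])
    show "AE \<omega> in M. ((\<lambda>u. g u \<omega>) \<longlongrightarrow> a * (S \<omega> - D \<omega>)) at_top"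
    proof (rule AE_I2)
      \<comment> \<open>For \<open>u\<close> beyond \<open>D\<close> the positive part is inactive,
        and the queue is merely translated by \<open>S - D\<close>.\<close>
      fix \<omega> assume "\<omega> \<in> space M"
      have "\<forall>\<^sub>F u in at_top. ((u + (S \<omega> - D \<omega>)) powr a - u powr a) / u powr (a - 1) = g u \<omega>"
        by (intro eventually_mono[OF eventually_gt_at_top[of "D \<omega>"]]) (simp add: g_def h_def algebra_simps)
      then show "((\<lambda>u. g u \<omega>) \<longlongrightarrow> a * (S \<omega> - D \<omega>)) at_top"
        by (rule Lim_transform_eventually[OF powr_increment_tendsto])
    qed
    show "\<forall>\<^sub>F u in at_top. AE \<omega> in M. norm (g u \<omega>) \<le> w \<omega>"
      using bound by (intro eventually_mono[OF eventually_ge_at_top[of 1]]) auto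
  qed (use int_w int_S int_D in auto)
  \<comment> \<open>Half of the absolute limiting drift, so that the mean of \<open>g u\<close> is
    eventually below \<open>- c\<close>.\<close>
  moreover define c where "c = a * (expectation D - expectation S) / 2"
  have "(\<integral>\<omega>. a * (S \<omega> - D \<omega>) \<partial>M) = - (2 * c)"
    using int_S int_D by (simp add: c_def field_simps)
  moreover have "0 < c"
    using drift \<open>1 < a\<close> by (simp add: c_def)
  ultimately have "\<forall>\<^sub>F u in at_top. (\<integral>\<omega>. g u \<omega> \<partial>M) < - c"
    by (intro order_tendstoD) auto
  then obtain u1 where u1: "\<And>u. u1 \<le> u \<Longrightarrow> (\<integral>\<omega>. g u \<omega> \<partial>M) < - c"
    by (auto simp: eventually_at_top_linorder)
  define u0 where "u0 = max 1 u1"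
  \<comment> \<open>Bounds the whole left-hand side for \<open>u < u0\<close>, where both of its
    terms are at most their counterparts at \<open>u0\<close>. From \<open>u0\<close> on the drift
    suffices.\<close>
  define C where "C = (\<integral>\<omega>. (u0 + S \<omega>) powr a \<partial>M) + c * u0 powr (a - 1)"
  have "0 \<le> C"
    using \<open>0 < c\<close> by (simp add: C_def)
  have "(\<integral>\<^sup>+\<omega>. ennreal (h u \<omega>) \<partial>M) + ennreal (c * u powr (a - 1)) \<le> ennreal (u powr a + C)"
    if "0 \<le> u" for u
  proof -
    have le_add: "h u \<omega> \<le> (u + S \<omega>) powr a" if "\<omega> \<in> space M" for \<omega>
      using \<open>0 \<le> u\<close> nonneg[OF that] \<open>1 < a\<close> by (auto simp: h_def intro!: powr_mono2)
    have int_h: "integrable M (h u)"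
      by (rule Bochner_Integration.integrable_bound[OF int_add[OF \<open>0 \<le> u\<close>]])
        (use le_add in \<open>auto simp: h_def intro!: AE_I2\<close>)
    have "(\<integral>\<omega>. h u \<omega> \<partial>M) + c * u powr (a - 1) \<le> u powr a + C"
    proof (cases "u0 \<le> u")
      case True
      then have "1 \<le> u" "u1 \<le> u" by (auto simp: u0_def)
      have "(\<integral>\<omega>. h u \<omega> \<partial>M) = (\<integral>\<omega>. g u \<omega> * u powr (a - 1) + u powr a \<partial>M)"
        using \<open>1 \<le> u\<close> by (simp add: g_def)
      also have "\<dots> = (\<integral>\<omega>. g u \<omega> \<partial>M) * u powr (a - 1) + u powr a"
        using int_g[OF \<open>1 \<le> u\<close>] by (simp add: prob_space)
      also have "(\<integral>\<omega>. g u \<omega> \<partial>M) * u powr (a - 1) \<le> - c * u powr (a - 1)"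
        using u1[OF \<open>u1 \<le> u\<close>] by (intro mult_right_mono) auto
      finally show ?thesis
        using \<open>0 \<le> C\<close> by simp
    next
      case False
      have "(\<integral>\<omega>. h u \<omega> \<partial>M) \<le> (\<integral>\<omega>. (u0 + S \<omega>) powr a \<partial>M)"
      proof (rule integral_mono[OF int_h int_add])
        fix \<omega> assume "\<omega> \<in> space M"
        then show "h u \<omega> \<le> (u0 + S \<omega>) powr a"
          using False \<open>0 \<le> u\<close> nonneg[of \<omega>] \<open>1 < a\<close> by (auto simp: h_def intro!: powr_mono2)
      qed (simp add: u0_def)
      moreover have "c * u powr (a - 1) \<le> c * u0 powr (a - 1)"
        using False \<open>0 \<le> u\<close> \<open>0 < c\<close> \<open>1 < a\<close> by (intro mult_left_mono powr_mono2) auto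
      moreover have "0 \<le> u powr a"
        by simp
      ultimately show ?thesis
        unfolding C_def by linarith
    qed
    moreover have "(\<integral>\<^sup>+\<omega>. ennreal (h u \<omega>) \<partial>M) = ennreal (\<integral>\<omega>. h u \<omega> \<partial>M)"
      using int_h by (rule nn_integral_eq_integral) (simp add: h_def)
    ultimately show ?thesis
      using \<open>0 < c\<close> by (simp add: ennreal_plus[symmetric] ennreal_leI h_def del: ennreal_plus)
  qed
  then show thesis
    using \<open>0 < c\<close> \<open>0 \<le> C\<close> by (intro that[of c C]) (auto simp: h_def)
qed

section \<open>Independence of paired sequences\<close>

lemma (in prob_space) indep_vars_reindex:
  assumes indep: "indep_vars M' X (h ` I)" and inj: "inj_on h I"
  shows "indep_vars (\<lambda>i. M' (h i)) (\<lambda>i. X (h i)) I"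
  unfolding indep_vars_def2
proof (intro conjI ballI indep_setsI)
  fix A J
  assume J: "J \<noteq> {}" "J \<subseteq> I" "finite J"
    and A: "\<forall>j\<in>J. A j \<in> {X (h j) -` B \<inter> space M |B. B \<in> sets (M' (h j))}"
  have inj_J: "inj_on h J"
    using inj J by (blast intro: inj_on_subset)
  have "prob (\<Inter>k\<in>h ` J. A (inv_into J h k)) = (\<Prod>k\<in>h ` J. prob (A (inv_into J h k)))"
    using indep J A inj_J unfolding indep_vars_def2
    by (intro indep_setsD[where F = "\<lambda>i. {X i -` A \<inter> space M |A. A \<in> sets (M' i)}"]) auto
  then show "prob (\<Inter>j\<in>J. A j) = (\<Prod>j\<in>J. prob (A j))"
    using inj_J by (simp add: prod.reindex)
qed (use indep in \<open>auto simp: indep_vars_def2\<close>)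

context prob_space
begin

lemma preimage_in_path_algebra:
  assumes X: "\<And>n. X n \<in> measurable M S" and A: "A \<in> sets S"
  shows "X n -` A \<inter> space M \<in> sets (vimage_algebra (space M) (\<lambda>\<omega> n. X n \<omega>) (PiM UNIV (\<lambda>_. S)))"
    (is "_ \<in> sets ?V")
proof -
  have "(\<lambda>\<omega> n. X n \<omega>) \<in> space M \<rightarrow> space (PiM UNIV (\<lambda>_. S))"
    using X[THEN measurable_space] by (auto simp: space_PiM)
  then have "(\<lambda>\<omega> n. X n \<omega>) \<in> measurable ?V (PiM UNIV (\<lambda>_. S))"
    by (rule measurable_vimage_algebra1)
  then have "X n \<in> measurable ?V S"
    by (rule measurable_compose) (rule measurable_component_singleton, simp)
  from measurable_sets[OF this A] show ?thesis
    by simp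
qed

text \<open>Finite intersections of coordinate events lie in the sigma-algebras of the two paths.
  The index maps \<open>g\<close> and \<open>h\<close> are free because interarrival times are later
  read at indices shifted against those of the marks.\<close>

lemma indep_seqs_prob:
  fixes X :: "int \<Rightarrow> 'a \<Rightarrow> 'b" and Y :: "int \<Rightarrow> 'a \<Rightarrow> 'c"
  assumes indep: "indep_seqs M S X S' Y" and J: "finite J" "J \<noteq> {}"
    and X: "\<And>n. X n \<in> measurable M S" and Y: "\<And>n. Y n \<in> measurable M S'"
    and sets: "\<And>j. j \<in> J \<Longrightarrow> A j \<in> sets S" "\<And>j. j \<in> J \<Longrightarrow> B j \<in> sets S'"
  shows "prob (\<Inter>j\<in>J. X (g j) -` A j \<inter> Y (h j) -` B j \<inter> space M)
    = prob (\<Inter>j\<in>J. X (g j) -` A j \<inter> space M) * prob (\<Inter>j\<in>J. Y (h j) -` B j \<inter> space M)"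
proof -
  have "prob ((\<Inter>j\<in>J. X (g j) -` A j \<inter> space M) \<inter> (\<Inter>j\<in>J. Y (h j) -` B j \<inter> space M))
    = prob (\<Inter>j\<in>J. X (g j) -` A j \<inter> space M) * prob (\<Inter>j\<in>J. Y (h j) -` B j \<inter> space M)"
  proof (rule indep_setD[OF indep[unfolded indep_seqs_def]])
    show "(\<Inter>j\<in>J. X (g j) -` A j \<inter> space M)
        \<in> sets (vimage_algebra (space M) (\<lambda>\<omega> n. X n \<omega>) (PiM UNIV (\<lambda>_. S)))"
      by (rule sets.finite_INT[OF J]) (intro preimage_in_path_algebra X sets)
    show "(\<Inter>j\<in>J. Y (h j) -` B j \<inter> space M)
        \<in> sets (vimage_algebra (space M) (\<lambda>\<omega> n. Y n \<omega>) (PiM UNIV (\<lambda>_. S')))"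
      by (rule sets.finite_INT[OF J]) (intro preimage_in_path_algebra Y sets)
  qed
  moreover have "(\<Inter>j\<in>J. X (g j) -` A j \<inter> space M) \<inter> (\<Inter>j\<in>J. Y (h j) -` B j \<inter> space M)
    = (\<Inter>j\<in>J. X (g j) -` A j \<inter> Y (h j) -` B j \<inter> space M)"
    by blast
  ultimately show ?thesis by simp
qed

lemma distr_indep_seqs:
  fixes X :: "int \<Rightarrow> 'a \<Rightarrow> 'b" and Y :: "int \<Rightarrow> 'a \<Rightarrow> 'c"
  assumes indep: "indep_seqs M S X S' Y"
    and [measurable]: "\<And>n. X n \<in> measurable M S" "\<And>n. Y n \<in> measurable M S'"
  shows "distr M (S' \<Otimes>\<^sub>M S) (\<lambda>\<omega>. (Y j \<omega>, X i \<omega>)) = distr M S' (Y j) \<Otimes>\<^sub>M distr M S (X i)"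
proof (rule pair_measure_eqI[symmetric])
  show "sigma_finite_measure (distr M S' (Y j))" "sigma_finite_measure (distr M S (X i))"
    by (simp_all add: prob_space_distr prob_space_imp_sigma_finite)
  fix B A assume "B \<in> sets (distr M S' (Y j))" "A \<in> sets (distr M S (X i))"
  then have [measurable]: "B \<in> sets S'" "A \<in> sets S" by simp_all
  \<comment> \<open>The one-point index set only serves to select the coordinates \<open>i\<close>
    and \<open>j\<close> by constant index maps.\<close>
  have "prob (Y j -` B \<inter> space M) * prob (X i -` A \<inter> space M) = prob (X i -` A \<inter> Y j -` B \<inter> space M)"
    using indep_seqs_prob[OF indep, of "{0::int}" "\<lambda>_. A" "\<lambda>_. B" "\<lambda>_. i" "\<lambda>_. j"]
    by (simp add: mult.commute)
  also have "X i -` A \<inter> Y j -` B \<inter> space M = (\<lambda>\<omega>. (Y j \<omega>, X i \<omega>)) -` (B \<times> A) \<inter> space M"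
    by auto
  finally show "emeasure (distr M S' (Y j)) B * emeasure (distr M S (X i)) A
      = emeasure (distr M (S' \<Otimes>\<^sub>M S) (\<lambda>\<omega>. (Y j \<omega>, X i \<omega>))) (B \<times> A)"
    by (simp add: emeasure_distr emeasure_eq_measure ennreal_mult'[symmetric])
qed (simp cong: sets_pair_measure_cong)

text \<open>Independence between the sequences and within each of them factorises the probabilities
  of rectangle events completely. Rectangles are stable under intersection, so independence extends
  to the sigma-algebras they generate.\<close>

lemma indep_vars_Pair:
  fixes X :: "int \<Rightarrow> 'a \<Rightarrow> 'b" and Y :: "int \<Rightarrow> 'a \<Rightarrow> 'c"
  assumes indep: "indep_seqs M S X S' Y"
    and X: "indep_vars (\<lambda>_. S) X UNIV" and Y: "indep_vars (\<lambda>_. S') Y UNIV" and inj: "inj h"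
  shows "indep_vars (\<lambda>_. S' \<Otimes>\<^sub>M S) (\<lambda>n \<omega>. (Y (h n) \<omega>, X n \<omega>)) UNIV"
proof -
  have [measurable]: "X n \<in> measurable M S" "Y n \<in> measurable M S'" for n
    using X Y by (auto simp: indep_vars_def2)
  have Yh: "indep_vars (\<lambda>_. S') (\<lambda>n. Y (h n)) UNIV"
    by (rule indep_vars_reindex[OF indep_vars_subset[OF Y subset_UNIV] inj])
  define E where "E n = {X n -` A \<inter> Y (h n) -` B \<inter> space M |A B. A \<in> sets S \<and> B \<in> sets S'}" for n
  have "indep_sets E UNIV"
  proof (rule indep_setsI)
    show "E n \<subseteq> events" for n
      by (auto simp: E_def)
    fix F J assume J: "J \<noteq> {}" "J \<subseteq> UNIV" "finite J" and FE: "\<forall>j\<in>J. F j \<in> E j"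
    have "\<forall>j\<in>J. \<exists>P. fst P \<in> sets S \<and> snd P \<in> sets S' \<and> F j = X j -` fst P \<inter> Y (h j) -` snd P \<inter> space M"
    proof
      fix j assume "j \<in> J"
      with FE have "F j \<in> E j" by (rule bspec)
      then obtain A B where "A \<in> sets S" "B \<in> sets S'" "F j = X j -` A \<inter> Y (h j) -` B \<inter> space M"
        unfolding E_def by blast
      then show "\<exists>P. fst P \<in> sets S \<and> snd P \<in> sets S' \<and> F j = X j -` fst P \<inter> Y (h j) -` snd P \<inter> space M"
        by (intro exI[of _ "(A, B)"]) simp
    qed
    from bchoice[OF this] obtain P where P: "\<forall>j\<in>J. fst (P j) \<in> sets S \<and> snd (P j) \<in> sets S'
        \<and> F j = X j -` fst (P j) \<inter> Y (h j) -` snd (P j) \<inter> space M"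
      by blast
    define A B where "A j = fst (P j)" and "B j = snd (P j)" for j
    have AB: "\<And>j. j \<in> J \<Longrightarrow> A j \<in> sets S" "\<And>j. j \<in> J \<Longrightarrow> B j \<in> sets S'"
      and F: "\<And>j. j \<in> J \<Longrightarrow> F j = X j -` A j \<inter> Y (h j) -` B j \<inter> space M"
      using P by (auto simp: A_def B_def)
    have "prob (F j) = prob (X j -` A j \<inter> space M) * prob (Y (h j) -` B j \<inter> space M)" if "j \<in> J" for j
      using indep_seqs_prob[OF indep, of "{j}" A B "\<lambda>n. n" h] that AB F by simp
    moreover have "prob (\<Inter>j\<in>J. F j)
        = prob (\<Inter>j\<in>J. X j -` A j \<inter> space M) * prob (\<Inter>j\<in>J. Y (h j) -` B j \<inter> space M)"
      using indep_seqs_prob[OF indep, of J A B "\<lambda>n. n" h] J AB F by simp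
    moreover have "prob (\<Inter>j\<in>J. X j -` A j \<inter> space M) = (\<Prod>j\<in>J. prob (X j -` A j \<inter> space M))"
      using J AB by (intro indep_varsD[OF X]) auto
    moreover have "prob (\<Inter>j\<in>J. Y (h j) -` B j \<inter> space M) = (\<Prod>j\<in>J. prob (Y (h j) -` B j \<inter> space M))"
      using J AB by (intro indep_varsD[OF Yh]) auto
    ultimately show "prob (\<Inter>j\<in>J. F j) = (\<Prod>j\<in>J. prob (F j))"
      by (simp add: prod.distrib)
  qed
  moreover have "Int_stable (E n)" for n
  proof (rule Int_stableI)
    fix a b assume "a \<in> E n" "b \<in> E n"
    then obtain A B A' B' where "A \<in> sets S" "B \<in> sets S'" "a = X n -` A \<inter> Y (h n) -` B \<inter> space M"
      and "A' \<in> sets S" "B' \<in> sets S'" "b = X n -` A' \<inter> Y (h n) -` B' \<inter> space M"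
      by (auto simp: E_def)
    then have "a \<inter> b = X n -` (A \<inter> A') \<inter> Y (h n) -` (B \<inter> B') \<inter> space M"
      and "A \<inter> A' \<in> sets S" "B \<inter> B' \<in> sets S'"
      by auto
    then show "a \<inter> b \<in> E n"
      unfolding E_def by blast
  qed
  ultimately have "indep_sets (\<lambda>n. sigma_sets (space M) (E n)) UNIV"
    by (rule indep_sets_sigma)
  then have "indep_sets (\<lambda>n. {(\<lambda>\<omega>. (Y (h n) \<omega>, X n \<omega>)) -` C \<inter> space M |C. C \<in> sets (S' \<Otimes>\<^sub>M S)}) UNIV"
  proof (rule indep_sets_mono_sets)
    \<comment> \<open>Preimages commute with generation, so the sigma-algebra of the pair is
      generated by preimages of rectangles, all of which belong to \<open>E n\<close>.\<close>
    fix n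
    have "{(\<lambda>\<omega>. (Y (h n) \<omega>, X n \<omega>)) -` C \<inter> space M |C. C \<in> sets (S' \<Otimes>\<^sub>M S)}
      = sigma_sets (space M) {(\<lambda>\<omega>. (Y (h n) \<omega>, X n \<omega>)) -` C \<inter> space M |C. C \<in> {b \<times> a |b a. b \<in> sets S' \<and> a \<in> sets S}}"
      unfolding sets_pair_measure
      by (rule sigma_sets_vimage_commute) (auto intro: measurable_space)
    also have "\<dots> \<subseteq> sigma_sets (space M) (E n)"
    proof (intro sigma_sets_mono' subsetI)
      fix x assume "x \<in> {(\<lambda>\<omega>. (Y (h n) \<omega>, X n \<omega>)) -` C \<inter> space M |C. C \<in> {b \<times> a |b a. b \<in> sets S' \<and> a \<in> sets S}}"
      then obtain A B where "A \<in> sets S" "B \<in> sets S'" and x: "x = (\<lambda>\<omega>. (Y (h n) \<omega>, X n \<omega>)) -` (B \<times> A) \<inter> space M"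
        by blast
      moreover have "x = X n -` A \<inter> Y (h n) -` B \<inter> space M"
        unfolding x by auto
      ultimately show "x \<in> E n"
        unfolding E_def by blast
    qed
    finally show "{(\<lambda>\<omega>. (Y (h n) \<omega>, X n \<omega>)) -` C \<inter> space M |C. C \<in> sets (S' \<Otimes>\<^sub>M S)} \<subseteq> sigma_sets (space M) (E n)" .
  qed
  then show ?thesis
    by (simp add: indep_vars_def2)
qed

end

section \<open>Blocks of customers\<close>

text \<open>
  Customer \<open>n\<close> carries the mark \<open>\<zeta>\<^sub>n\<close> and the interarrival time \<open>\<tau>\<^bsub>n-1\<^esub>\<close> preceding it:
  this pairing makes the daters of disjoint blocks functions of disjoint sets of customers.
\<close>

definition customer :: "(int \<Rightarrow> 'a \<Rightarrow> real) \<Rightarrow> (int \<Rightarrow> 'a \<Rightarrow> 'k) \<Rightarrow> int \<Rightarrow> 'a \<Rightarrow> real \<times> 'k" where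
  "customer T \<zeta> n \<omega> = (interarrival T (n - 1) \<omega>, \<zeta> n \<omega>)"

text \<open>Indices count from the start of the block, so that blocks at different positions live in
  one product space and their laws can be compared.\<close>

definition block ::
  "(int \<Rightarrow> 'a \<Rightarrow> real) \<Rightarrow> (int \<Rightarrow> 'a \<Rightarrow> 'k) \<Rightarrow> int \<Rightarrow> nat \<Rightarrow> 'a \<Rightarrow> nat \<Rightarrow> real \<times> 'k" where
  "block T \<zeta> m l \<omega> = (\<lambda>i\<in>{..<l}. customer T \<zeta> (m + int i) \<omega>)"

text \<open>Epochs relative to the first customer of the block. The sum starts at \<open>1\<close>
  because coordinate \<open>0\<close> carries the interarrival time before the block.\<close>

definition block_epoch :: "(nat \<Rightarrow> real \<times> 'k) \<Rightarrow> nat \<Rightarrow> real" where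
  "block_epoch y i = (\<Sum>j\<in>{1..i}. fst (y j))"

text \<open>With the epochs as a parameter, one definition serves the actual input,
  \<open>e = block_epoch\<close>, and the input \<open>Q\<close>, \<open>e\<close> constantly
  \<open>0\<close>. Index \<open>l\<close> is the last of \<open>Suc l\<close> customers.\<close>

definition block_max_dater ::
  "'k functional \<Rightarrow> ((nat \<Rightarrow> real \<times> 'k) \<Rightarrow> nat \<Rightarrow> real) \<Rightarrow> nat \<Rightarrow> (nat \<Rightarrow> real \<times> 'k) \<Rightarrow> real" where
  "block_max_dater f e l y =
     f (Suc l) (\<lambda>i\<in>{..<Suc l}. e y i, \<lambda>i\<in>{..<Suc l}. snd (y i)) - e y l"

locale iid_network = monotone_separable_network M K f T \<zeta> rate
  for M :: "'a measure" and K :: "'k measure" and f T \<zeta> rate +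
  assumes IA: "IA M K T \<zeta>"
begin

abbreviation N :: "(real \<times> 'k) measure" where "N \<equiv> borel \<Otimes>\<^sub>M K"
abbreviation "Z m n \<omega> \<equiv> max_dater f (\<lambda>k. \<zeta> k \<omega>) m n (\<lambda>k. T k \<omega>)"
abbreviation "R m n \<omega> \<equiv> max_dater f (\<lambda>k. \<zeta> k \<omega>) m n (\<lambda>_. 0)"

section \<open>Laws and independence of blocks\<close>

lemma interarrival_measurable [measurable]: "interarrival T n \<in> borel_measurable M"
  using interarrival_integrable by (rule borel_measurable_integrable)

declare mark_measurable [measurable] epoch_measurable [measurable]

lemma customer_measurable [measurable]: "customer T \<zeta> n \<in> measurable M N"
  unfolding customer_def[abs_def] by simp

lemma indep_customers: "indep_vars (\<lambda>_. N) (customer T \<zeta>) UNIV"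
  using indep_vars_Pair[of K \<zeta> borel "interarrival T" "\<lambda>n. n - 1"] IA
  by (simp add: customer_def[abs_def] IA_def iid_seq_def)

lemma distr_customer: "distr M N (customer T \<zeta> n) = distr M N (customer T \<zeta> 0)"
proof -
  have "indep_seqs M K \<zeta> borel (interarrival T)"
    and "distr M K (\<zeta> n) = distr M K (\<zeta> 0)"
    and "distr M borel (interarrival T (n - 1)) = distr M borel (interarrival T 0)"
    and "distr M borel (interarrival T (0 - 1)) = distr M borel (interarrival T 0)"
    using IA unfolding IA_def iid_seq_def by blast+
  then show ?thesis
    by (simp only: customer_def[abs_def] distr_indep_seqs mark_measurable interarrival_measurable)
qed

lemma block_measurable [measurable]: "block T \<zeta> m l \<in> measurable M (PiM {..<l} (\<lambda>_. N))"
  unfolding block_def[abs_def] by (intro measurable_restrict) simp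

text \<open>Customers are independent with a common law. As the product measure does not involve
  \<open>m\<close>, integrals of functions of a block are shift invariant.\<close>

lemma distr_block:
  assumes "l \<noteq> 0"
  shows "distr M (PiM {..<l} (\<lambda>_. N)) (block T \<zeta> m l) = PiM {..<l} (\<lambda>_. distr M N (customer T \<zeta> 0))"
proof -
  have "indep_vars (\<lambda>_. N) (\<lambda>i. customer T \<zeta> (m + int i)) {..<l}"
    by (rule indep_vars_reindex[OF indep_vars_subset[OF indep_customers subset_UNIV]])
      (simp add: inj_on_def)
  then have "distr M (PiM {..<l} (\<lambda>_. N)) (block T \<zeta> m l)
      = PiM {..<l} (\<lambda>i. distr M N (customer T \<zeta> (m + int i)))"
    using assms unfolding block_def[abs_def] by (subst (asm) indep_vars_iff_distr_eq_PiM) auto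
  also have "\<dots> = PiM {..<l} (\<lambda>_. distr M N (customer T \<zeta> 0))"
    by (intro PiM_cong refl distr_customer)
  finally show ?thesis .
qed

lemma distr_block_eq:
  "distr M (PiM {..<l} (\<lambda>_. N)) (block T \<zeta> m l) = distr M (PiM {..<l} (\<lambda>_. N)) (block T \<zeta> m' l)"
proof (cases "l = 0")
  case True
  then have "block T \<zeta> m l = block T \<zeta> m' l"
    by (simp add: block_def fun_eq_iff)
  then show ?thesis by simp
qed (simp add: distr_block)

lemma nn_integral_block:
  assumes [measurable]: "g \<in> borel_measurable (PiM {..<l} (\<lambda>_. N))"
  shows "(\<integral>\<^sup>+\<omega>. g (block T \<zeta> m l \<omega>) \<partial>M) = (\<integral>\<^sup>+\<omega>. g (block T \<zeta> m' l \<omega>) \<partial>M)"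
  using arg_cong[OF distr_block_eq, of "\<lambda>D. \<integral>\<^sup>+y. g y \<partial>D" l m m'] by (simp add: nn_integral_distr)

lemma
  fixes g :: "(nat \<Rightarrow> real \<times> 'k) \<Rightarrow> real"
  assumes [measurable]: "g \<in> borel_measurable (PiM {..<l} (\<lambda>_. N))"
  shows expectation_block: "(\<integral>\<omega>. g (block T \<zeta> m l \<omega>) \<partial>M) = (\<integral>\<omega>. g (block T \<zeta> m' l \<omega>) \<partial>M)"
    and integrable_block:
      "integrable M (\<lambda>\<omega>. g (block T \<zeta> m l \<omega>)) \<longleftrightarrow> integrable M (\<lambda>\<omega>. g (block T \<zeta> m' l \<omega>))"
  using arg_cong[OF distr_block_eq, of "\<lambda>D. \<integral>y. g y \<partial>D" l m m']
    arg_cong[OF distr_block_eq, of "\<lambda>D. integrable D g" l m m']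
  by (simp_all add: integral_distr integrable_distr_eq)

lemma indep_blocks:
  assumes "m + int l \<le> m'"
  shows "indep_var (PiM {..<l} (\<lambda>_. N)) (block T \<zeta> m l) (PiM {..<l'} (\<lambda>_. N)) (block T \<zeta> m' l')"
proof -
  let ?A = "{m..<m + int l}" and ?B = "{m'..<m' + int l'}"
  \<comment> \<open>Relabels customers \<open>k, ..., k + n - 1\<close> as
    \<open>0, ..., n - 1\<close>.\<close>
  define F where "F k n x = (\<lambda>i\<in>{..<n}. x (k + int i))" for k :: int and n and x :: "int \<Rightarrow> real \<times> 'k"
  have F: "F k n \<in> measurable (PiM {k..<k + int n} (\<lambda>_. N)) (PiM {..<n} (\<lambda>_. N))" for k n
    unfolding F_def[abs_def] by (intro measurable_restrict measurable_component_singleton) auto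
  have "indep_var (PiM ?A (\<lambda>_. N)) (\<lambda>\<omega>. \<lambda>i\<in>?A. customer T \<zeta> i \<omega>)
      (PiM ?B (\<lambda>_. N)) (\<lambda>\<omega>. \<lambda>i\<in>?B. customer T \<zeta> i \<omega>)"
    using assms by (intro indep_var_restrict[OF indep_customers]) auto
  from indep_var_compose[OF this F F]
  have "indep_var (PiM {..<l} (\<lambda>_. N)) (F m l \<circ> (\<lambda>\<omega>. \<lambda>i\<in>?A. customer T \<zeta> i \<omega>))
      (PiM {..<l'} (\<lambda>_. N)) (F m' l' \<circ> (\<lambda>\<omega>. \<lambda>i\<in>?B. customer T \<zeta> i \<omega>))" .
  moreover have "F k n \<circ> (\<lambda>\<omega>. \<lambda>i\<in>{k..<k + int n}. customer T \<zeta> i \<omega>) = block T \<zeta> k n" for k n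
    by (auto simp: F_def block_def fun_eq_iff)
  ultimately show ?thesis by simp
qed

section \<open>Maximal daters as measurable functions of blocks\<close>

lemma coordinate_measurable [measurable]:
  "i < l \<Longrightarrow> (\<lambda>y. y i) \<in> measurable (PiM {..<l} (\<lambda>_. N)) N"
  by (rule measurable_component_singleton) simp

lemma block_epoch_measurable [measurable]:
  "i < l \<Longrightarrow> (\<lambda>y. block_epoch y i) \<in> borel_measurable (PiM {..<l} (\<lambda>_. N))"
  unfolding block_epoch_def
  by (intro borel_measurable_sum measurable_compose[OF coordinate_measurable measurable_fst]) auto

lemma block_max_dater_measurable:
  assumes [measurable]: "\<And>i. i < Suc l \<Longrightarrow> (\<lambda>y. e y i) \<in> borel_measurable (PiM {..<Suc l} (\<lambda>_. N))"
  shows "block_max_dater f e l \<in> borel_measurable (PiM {..<Suc l} (\<lambda>_. N))"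
proof -
  have [measurable]: "(\<lambda>y. \<lambda>i\<in>{..<Suc l}. e y i) \<in> measurable (PiM {..<Suc l} (\<lambda>_. N)) (PiM {..<Suc l} (\<lambda>_. borel))"
    by (intro measurable_restrict) auto
  have [measurable]: "(\<lambda>y. \<lambda>i\<in>{..<Suc l}. snd (y i)) \<in> measurable (PiM {..<Suc l} (\<lambda>_. N)) (PiM {..<Suc l} (\<lambda>_. K))"
    by (intro measurable_restrict measurable_compose[OF coordinate_measurable measurable_snd]) auto
  have [measurable]: "f (Suc l) \<in> borel_measurable (PiM {..<Suc l} (\<lambda>_. borel) \<Otimes>\<^sub>M PiM {..<Suc l} (\<lambda>_. K))"
    by (rule functional_measurable) simp
  show ?thesis
    unfolding block_max_dater_def[abs_def] by measurable
qed

lemma block_epoch_block: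
  assumes "i < l"
  shows "block_epoch (block T \<zeta> m l \<omega>) i = T (m + int i) \<omega> - T m \<omega>"
  using assms
proof (induction i)
  case (Suc i)
  then show ?case
    by (simp add: block_epoch_def block_def customer_def interarrival_def algebra_simps)
qed (simp add: block_epoch_def)

text \<open>By homogeneity customer \<open>m\<close> may be taken to arrive at time
  \<open>0\<close>; the interarrival times of the block then determine all other epochs.\<close>

lemma max_dater_block:
  assumes "\<omega> \<in> space M"
  shows "Z m (m + int l) \<omega> = block_max_dater f block_epoch l (block T \<zeta> m (Suc l) \<omega>)"
proof -
  let ?y = "block T \<zeta> m (Suc l) \<omega>"
  have "Z m (m + int l) \<omega> = max_dater f (\<lambda>k. \<zeta> k \<omega>) m (m + int l) (\<lambda>k. - T m \<omega> + T k \<omega>)"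
    by (rule max_dater_add[OF separable epochs_mono, symmetric]) (use assms in auto)
  also have "\<dots> = block_max_dater f block_epoch l ?y"
  proof -
    have "nat (m + int l - m + 1) = Suc l" by simp
    moreover have "(\<lambda>i\<in>{..<Suc l}. - T m \<omega> + T (m + int i) \<omega>) = (\<lambda>i\<in>{..<Suc l}. block_epoch ?y i)"
      by (rule restrict_ext) (simp add: block_epoch_block)
    moreover have "(\<lambda>i\<in>{..<Suc l}. \<zeta> (m + int i) \<omega>) = (\<lambda>i\<in>{..<Suc l}. snd (?y i))"
      by (rule restrict_ext) (simp add: block_def customer_def)
    ultimately show ?thesis
      by (simp only: max_dater_def dater_def block_max_dater_def Let_def) (simp add: block_epoch_block)
  qed
  finally show ?thesis .
qed

lemma zero_max_dater_block: "R m (m + int l) \<omega> = block_max_dater f (\<lambda>_ _. 0) l (block T \<zeta> m (Suc l) \<omega>)"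
proof -
  have "nat (m + int l - m + 1) = Suc l" by simp
  moreover have "(\<lambda>i\<in>{..<Suc l}. \<zeta> (m + int i) \<omega>) = (\<lambda>i\<in>{..<Suc l}. snd (block T \<zeta> m (Suc l) \<omega> i))"
    by (rule restrict_ext) (simp add: block_def customer_def)
  ultimately show ?thesis
    by (simp only: max_dater_def dater_def block_max_dater_def Let_def)
qed

section \<open>Moments of maximal daters for the zero input\<close>

lemma zero_mono: "mono (\<lambda>_::int. 0::real)"
  by (rule monoI) simp

lemma Z_measurable: "m \<le> n \<Longrightarrow> Z m n \<in> borel_measurable M"
  using max_dater_block[where m = m and l = "nat (n - m)"]
    block_max_dater_measurable[of "nat (n - m)" block_epoch, OF block_epoch_measurable]
  by (subst measurable_cong[where g = "\<lambda>\<omega>. block_max_dater f block_epoch (nat (n - m)) (block T \<zeta> m (Suc (nat (n - m))) \<omega>)"]) auto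

lemma R_measurable: "m \<le> n \<Longrightarrow> R m n \<in> borel_measurable M"
  using zero_max_dater_block[where m = m and l = "nat (n - m)"]
    block_max_dater_measurable[of "nat (n - m)" "\<lambda>_ _. 0"]
  by (subst measurable_cong[where g = "\<lambda>\<omega>. block_max_dater f (\<lambda>_ _. 0) (nat (n - m)) (block T \<zeta> m (Suc (nat (n - m))) \<omega>)"]) auto

lemma Z_nonneg: "\<omega> \<in> space M \<Longrightarrow> m \<le> n \<Longrightarrow> 0 \<le> Z m n \<omega>"
  and R_nonneg: "\<omega> \<in> space M \<Longrightarrow> m \<le> n \<Longrightarrow> 0 \<le> R m n \<omega>"
  by (simp_all add: max_dater_nonneg[OF separable] epochs_mono zero_mono)

lemma Z_single: "\<omega> \<in> space M \<Longrightarrow> Z n n \<omega> = R n n \<omega>"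
  by (rule max_dater_single[OF separable])

lemma R_single_integrable: "integrable M (R n n)"
  using max_dater_integrable[of n] by (subst (asm) Bochner_Integration.integrable_cong[OF refl Z_single])

lemma R_subadditive:
  "\<omega> \<in> space M \<Longrightarrow> m \<le> l \<Longrightarrow> l < n \<Longrightarrow> R m n \<omega> \<le> R m l \<omega> + R (l + 1) n \<omega>"
  by (rule max_dater_zero_subadditive[OF separable])

text \<open>Subadditivity bounds the dater of a block by the sum of the daters of its single
  customers.\<close>

lemma R_integrable: "integrable M (R m (m + int l))"
proof (induction l)
  case 0
  show ?case
    using R_single_integrable[of m] by simp
next
  case (Suc l)
  let ?n = "m + int (Suc l)"
  have "integrable M (R ?n ?n)"
    by (rule R_single_integrable)
  with Suc have "integrable M (\<lambda>\<omega>. R m (m + int l) \<omega> + R ?n ?n \<omega>)"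
    by (rule Bochner_Integration.integrable_add)
  then show ?case
  proof (rule Bochner_Integration.integrable_bound)
    show "R m ?n \<in> borel_measurable M"
      by (rule R_measurable) simp
    show "AE \<omega> in M. norm (R m ?n \<omega>) \<le> norm (R m (m + int l) \<omega> + R ?n ?n \<omega>)"
    proof (rule AE_I2)
      fix \<omega> assume \<omega>: "\<omega> \<in> space M"
      have "R m ?n \<omega> \<le> R m (m + int l) \<omega> + R ?n ?n \<omega>"
        using R_subadditive[OF \<omega>, where m = m and l = "m + int l" and n = ?n] by (simp add: ac_simps)
      moreover have "0 \<le> R m ?n \<omega>"
        using \<omega> by (rule R_nonneg) simp
      ultimately show "norm (R m ?n \<omega>) \<le> norm (R m (m + int l) \<omega> + R ?n ?n \<omega>)"
        by simp
    qed
  qed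
qed

lemma R_powr_integrable:
  assumes "1 < \<alpha>" and moment: "integrable M (\<lambda>\<omega>. Z 0 0 \<omega> powr \<alpha>)"
  shows "integrable M (\<lambda>\<omega>. R m (m + int l) \<omega> powr \<alpha>)"
proof (induction l)
  \<comment> \<open>The moment is given for customer \<open>0\<close>; equality of block laws
    transfers it to every customer.\<close>
  have single: "integrable M (\<lambda>\<omega>. R n n \<omega> powr \<alpha>)" for n
  proof -
    have "integrable M (\<lambda>\<omega>. R 0 0 \<omega> powr \<alpha>)"
      using moment by (subst (asm) Bochner_Integration.integrable_cong[OF refl]) (simp_all add: Z_single)
    then have "integrable M (\<lambda>\<omega>. block_max_dater f (\<lambda>_ _. 0) 0 (block T \<zeta> 0 (Suc 0) \<omega>) powr \<alpha>)"
      using zero_max_dater_block[where m = 0 and l = 0] by simp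
    moreover have "(\<lambda>y. block_max_dater f (\<lambda>_ _. 0) 0 y powr \<alpha>) \<in> borel_measurable (PiM {..<Suc 0} (\<lambda>_. N))"
      using block_max_dater_measurable[of 0 "\<lambda>_ _. 0"] by simp
    ultimately have "integrable M (\<lambda>\<omega>. block_max_dater f (\<lambda>_ _. 0) 0 (block T \<zeta> n (Suc 0) \<omega>) powr \<alpha>)"
      by (subst (asm) integrable_block)
    then show ?thesis
      using zero_max_dater_block[where m = n and l = 0] by simp
  qed
  case 0
  show ?case
    using single[of m] by simp
  case (Suc l)
  let ?n = "m + int (Suc l)"
  have "integrable M (\<lambda>\<omega>. (R m (m + int l) \<omega> + R ?n ?n \<omega>) powr \<alpha>)"
    using \<open>1 < \<alpha>\<close> by (intro powr_sum_integrable R_measurable R_nonneg Suc single) auto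
  then show ?case
  proof (rule Bochner_Integration.integrable_bound)
    show "(\<lambda>\<omega>. R m ?n \<omega> powr \<alpha>) \<in> borel_measurable M"
      by (intro powr_real_measurable R_measurable borel_measurable_const) simp
    show "AE \<omega> in M. norm (R m ?n \<omega> powr \<alpha>) \<le> norm ((R m (m + int l) \<omega> + R ?n ?n \<omega>) powr \<alpha>)"
    proof (rule AE_I2)
      fix \<omega> assume \<omega>: "\<omega> \<in> space M"
      have "R m ?n \<omega> \<le> R m (m + int l) \<omega> + R ?n ?n \<omega>"
        using R_subadditive[OF \<omega>, where m = m and l = "m + int l" and n = ?n] by (simp add: ac_simps)
      moreover have "0 \<le> R m ?n \<omega>"
        using \<omega> by (rule R_nonneg) simp
      ultimately show "norm (R m ?n \<omega> powr \<alpha>) \<le> norm ((R m (m + int l) \<omega> + R ?n ?n \<omega>) powr \<alpha>)"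
        using \<open>1 < \<alpha>\<close> by (simp add: powr_mono2)
    qed
  qed
qed

lemma expectation_R_shift: "expectation (R m (m + int l)) = expectation (R m' (m' + int l))"
proof -
  have "block_max_dater f (\<lambda>_ _. 0) l \<in> borel_measurable (PiM {..<Suc l} (\<lambda>_. N))"
    by (rule block_max_dater_measurable) simp
  from expectation_block[OF this, of m m'] show ?thesis
    by (simp only: zero_max_dater_block)
qed

text \<open>By shift invariance the mean daters depend on the number of customers only, and they are
  subadditive in it. Hence \<open>gamma0\<close> is an infimum, and some block length already beats
  \<open>x\<close>.\<close>

lemma gamma0_less_imp_block:
  assumes "gamma0 M f \<zeta> < x"
  obtains r where "expectation (R 1 (1 + int r)) < real (Suc r) * x"
proof -
  \<comment> \<open>Mean for \<open>n\<close> customers, so \<open>Suc r\<close> customers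
    correspond to \<open>R m (m + int r)\<close>. The value at \<open>0\<close> is set by hand
    because no customer lies between \<open>0\<close> and \<open>- 1\<close>.\<close>
  define a where "a n = (if n = 0 then 0 else expectation (R (- int n) (- 1)))" for n :: nat
  have a_Suc: "a (Suc r) = expectation (R m (m + int r))" for r m
    using expectation_R_shift[of "- int (Suc r)" r m] by (simp add: a_def)
  have sub: "a (m + n) \<le> a m + a n" for m n
  proof (cases "m = 0 \<or> n = 0")
    case False
    then obtain p q where mn: "m = Suc p" "n = Suc q"
      by (metis not0_implies_Suc)
    \<comment> \<open>First customer of the second block: the first one consists of
      \<open>0, ..., p\<close>.\<close>
    define k where "k = int p + 1"
    have "a (m + n) = a (Suc (p + n))"
      by (simp add: mn)
    also have "\<dots> = expectation (R 0 (k + int q))"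
      unfolding a_Suc[of _ 0] by (simp add: k_def mn ac_simps)
    also have "\<dots> \<le> expectation (\<lambda>\<omega>. R 0 (int p) \<omega> + R k (k + int q) \<omega>)"
    proof (rule integral_mono)
      show "integrable M (R 0 (k + int q))"
        using R_integrable[of 0 "Suc p + q"] by (simp add: k_def ac_simps)
      show "integrable M (\<lambda>\<omega>. R 0 (int p) \<omega> + R k (k + int q) \<omega>)"
        using R_integrable[of 0 p] R_integrable[of k q] by (intro Bochner_Integration.integrable_add) simp_all
      show "R 0 (k + int q) \<omega> \<le> R 0 (int p) \<omega> + R k (k + int q) \<omega>" if "\<omega> \<in> space M" for \<omega>
        using R_subadditive[OF that, where m = 0 and l = "int p" and n = "k + int q"] by (simp add: k_def)
    qed
    also have "\<dots> = expectation (R 0 (0 + int p)) + expectation (R k (k + int q))"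
      using R_integrable[of 0 p] R_integrable[of k q] by simp
    also have "\<dots> = a m + a n"
      by (simp only: mn a_Suc[of p 0] a_Suc[of q k])
    finally show ?thesis .
  qed (auto simp: a_def)
  have nonneg: "0 \<le> a n" for n
    by (auto simp: a_def intro!: integral_nonneg_AE AE_I2 R_nonneg)
  have "(\<lambda>n. a n / real n) \<longlonglongrightarrow> (INF n\<in>{1..}. a n / real n)"
    using sub nonneg by (rule subadditive_convergent)
  moreover have "(\<lambda>n. a n / real n) = (\<lambda>n. expectation (R (- int n) (- 1)) / real n)"
    by (auto simp: a_def)
  ultimately have "gamma0 M f \<zeta> = (INF n\<in>{1..}. a n / real n)"
    unfolding gamma0_def by (simp add: limI)
  moreover have "bdd_below ((\<lambda>n. a n / real n) ` {1..})"
    using nonneg by (intro bdd_belowI[of _ 0]) auto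
  ultimately obtain n where "1 \<le> n" "a n / real n < x"
    using assms by (auto simp: cINF_less_iff)
  moreover then obtain r where "n = Suc r"
    by (cases n) auto
  ultimately have "a (Suc r) < real (Suc r) * x"
    by (simp add: field_simps)
  then show thesis
    by (intro that[of r]) (simp only: a_Suc[of r 1])
qed

section \<open>Arrival times of blocks and the recursion in mean\<close>

lemma epoch_diff_sum: "T (m + int l) \<omega> - T m \<omega> = (\<Sum>i<l. interarrival T (m + int i) \<omega>)"
  by (induction l) (simp_all add: interarrival_def algebra_simps)

text \<open>Each customer carries the interarrival time before it, so the way from \<open>m\<close>
  to \<open>m + l\<close> is stored in customers \<open>m + 1, ..., m + l\<close>. Thus both
  ingredients of the recursion are functions of the same block.\<close>

lemma epoch_diff_block:
  "T (m + int l) \<omega> - T m \<omega> = (\<Sum>i<l. fst (block T \<zeta> (m + 1) l \<omega> i))"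
  unfolding epoch_diff_sum by (rule sum.cong) (simp_all add: block_def customer_def)

lemma epoch_diff_integrable: "integrable M (\<lambda>\<omega>. T (m + int l) \<omega> - T m \<omega>)"
  unfolding epoch_diff_sum by (intro Bochner_Integration.integrable_sum interarrival_integrable)

lemma expectation_epoch_diff: "expectation (\<lambda>\<omega>. T (m + int l) \<omega> - T m \<omega>) = real l / rate"
  unfolding epoch_diff_sum
  by (simp add: Bochner_Integration.integral_sum interarrival_integrable interarrival_mean field_simps)

lemma nn_integral_Z_shift:
  "(\<integral>\<^sup>+\<omega>. ennreal (Z m (m + int l) \<omega> powr p) \<partial>M) = (\<integral>\<^sup>+\<omega>. ennreal (Z m' (m' + int l) \<omega> powr p) \<partial>M)"
proof -
  let ?g = "\<lambda>y. ennreal (block_max_dater f block_epoch l y powr p)"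
  have [measurable]: "block_max_dater f block_epoch l \<in> borel_measurable (PiM {..<Suc l} (\<lambda>_. N))"
    by (rule block_max_dater_measurable) simp
  have "(\<integral>\<^sup>+\<omega>. ennreal (Z k (k + int l) \<omega> powr p) \<partial>M) = (\<integral>\<^sup>+\<omega>. ?g (block T \<zeta> k (Suc l) \<omega>) \<partial>M)" for k
    by (rule nn_integral_cong) (simp add: max_dater_block)
  moreover have "(\<integral>\<^sup>+\<omega>. ?g (block T \<zeta> m (Suc l) \<omega>) \<partial>M) = (\<integral>\<^sup>+\<omega>. ?g (block T \<zeta> m' (Suc l) \<omega>) \<partial>M)"
    by (rule nn_integral_block) simp
  ultimately show ?thesis by simp
qed

text \<open>
  The block of \<open>Suc r\<close> customers following customer \<open>n\<close> is independent of the past,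
  hence may be resampled as the block following customer \<open>0\<close>.
\<close>

lemma nn_integral_Z_recursion:
  assumes "0 < a"
  shows "(\<integral>\<^sup>+\<omega>. ennreal (Z 0 (int (n + Suc r)) \<omega> powr a) \<partial>M)
    \<le> (\<integral>\<^sup>+\<omega>. (\<integral>\<^sup>+\<omega>'. ennreal ((R 1 (1 + int r) \<omega>'
          + max 0 (Z 0 (int n) \<omega> - (T (0 + int (Suc r)) \<omega>' - T 0 \<omega>'))) powr a) \<partial>M) \<partial>M)"
proof -
  let ?P = "PiM {..<Suc n} (\<lambda>_. N)" and ?Q = "PiM {..<Suc r} (\<lambda>_. N)"
  \<comment> \<open>The bound of the recursion as a function of the past block \<open>x\<close> and
    the new block \<open>y\<close>.\<close>
  define G where "G = (\<lambda>(x, y). ennreal ((block_max_dater f (\<lambda>_ _. 0) r y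
    + max 0 (block_max_dater f block_epoch n x - (\<Sum>i<Suc r. fst (y i)))) powr a))"
  have [measurable]: "block_max_dater f block_epoch n \<in> borel_measurable ?P"
    and [measurable]: "block_max_dater f (\<lambda>_ _. 0) r \<in> borel_measurable ?Q"
    by (rule block_max_dater_measurable; simp)+
  have [measurable]: "(\<lambda>y. \<Sum>i<Suc r. fst (y i)) \<in> borel_measurable ?Q"
    by (intro borel_measurable_sum measurable_compose[OF coordinate_measurable measurable_fst]) auto
  have G [measurable]: "G \<in> borel_measurable (?P \<Otimes>\<^sub>M ?Q)"
    unfolding G_def by measurable
  \<comment> \<open>Stated for two sample points and any \<open>m\<close>: it is used with equal
    points and \<open>m = int n\<close> before the resampling, with distinct ones and
    \<open>m = 0\<close> after it.\<close>
  have G_block: "G (block T \<zeta> 0 (Suc n) \<omega>, block T \<zeta> (m + 1) (Suc r) \<omega>')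
      = ennreal ((R (m + 1) (m + 1 + int r) \<omega>'
          + max 0 (Z 0 (int n) \<omega> - (T (m + int (Suc r)) \<omega>' - T m \<omega>'))) powr a)"
    if "\<omega> \<in> space M" for m \<omega> \<omega>'
    using max_dater_block[OF that, of 0 n]
    by (simp only: G_def prod.case zero_max_dater_block epoch_diff_block add_0)
  have "(\<integral>\<^sup>+\<omega>. ennreal (Z 0 (int (n + Suc r)) \<omega> powr a) \<partial>M)
      \<le> (\<integral>\<^sup>+\<omega>. G (block T \<zeta> 0 (Suc n) \<omega>, block T \<zeta> (int n + 1) (Suc r) \<omega>) \<partial>M)"
  proof (rule nn_integral_mono)
    fix \<omega> assume \<omega>: "\<omega> \<in> space M"
    have "Z 0 (int n + int (Suc r)) \<omega> \<le> R (int n + 1) (int n + int (Suc r)) \<omega>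
        + max 0 (Z 0 (int n) \<omega> - (T (int n + int (Suc r)) \<omega> - T (int n) \<omega>))"
      using \<omega> by (intro max_dater_recursion[OF separable epochs_mono]) auto
    then have "Z 0 (int (n + Suc r)) \<omega> powr a \<le> (R (int n + 1) (int n + 1 + int r) \<omega>
        + max 0 (Z 0 (int n) \<omega> - (T (int n + int (Suc r)) \<omega> - T (int n) \<omega>))) powr a"
      using Z_nonneg[OF \<omega>, where m = 0 and n = "int (n + Suc r)"] \<open>0 < a\<close>
      by (intro powr_mono2) (simp_all add: ac_simps)
    then show "ennreal (Z 0 (int (n + Suc r)) \<omega> powr a)
        \<le> G (block T \<zeta> 0 (Suc n) \<omega>, block T \<zeta> (int n + 1) (Suc r) \<omega>)"
      unfolding G_block[OF \<omega>] by (rule ennreal_leI)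
  qed
  also have "\<dots> = (\<integral>\<^sup>+\<omega>. (\<integral>\<^sup>+\<omega>'. G (block T \<zeta> 0 (Suc n) \<omega>, block T \<zeta> (int n + 1) (Suc r) \<omega>') \<partial>M) \<partial>M)"
    by (rule nn_integral_indep_var[OF indep_blocks G]) simp
  also have "\<dots> = (\<integral>\<^sup>+\<omega>. (\<integral>\<^sup>+\<omega>'. G (block T \<zeta> 0 (Suc n) \<omega>, block T \<zeta> (0 + 1) (Suc r) \<omega>') \<partial>M) \<partial>M)"
  proof (rule nn_integral_cong)
    fix \<omega> assume "\<omega> \<in> space M"
    then have [measurable]: "block T \<zeta> 0 (Suc n) \<omega> \<in> space ?P"
      by (rule measurable_space[OF block_measurable])
    show "(\<integral>\<^sup>+\<omega>'. G (block T \<zeta> 0 (Suc n) \<omega>, block T \<zeta> (int n + 1) (Suc r) \<omega>') \<partial>M)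
        = (\<integral>\<^sup>+\<omega>'. G (block T \<zeta> 0 (Suc n) \<omega>, block T \<zeta> (0 + 1) (Suc r) \<omega>') \<partial>M)"
      by (rule nn_integral_block[where g = "\<lambda>y. G (block T \<zeta> 0 (Suc n) \<omega>, y)"]) simp
  qed
  also have "\<dots> = (\<integral>\<^sup>+\<omega>. (\<integral>\<^sup>+\<omega>'. ennreal ((R 1 (1 + int r) \<omega>'
          + max 0 (Z 0 (int n) \<omega> - (T (0 + int (Suc r)) \<omega>' - T 0 \<omega>'))) powr a) \<partial>M) \<partial>M)"
    using G_block[of _ 0] by (intro nn_integral_cong) (simp only: add_0)
  finally show ?thesis .
qed

section \<open>Boundedness of the stationary moment\<close>

lemma stationary_max_dater_moment:
  assumes stability: "rate * gamma0 M f \<zeta> < 1" and "1 < \<alpha>"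
    and moment: "integrable M (\<lambda>\<omega>. Z 0 0 \<omega> powr \<alpha>)"
  shows "(\<integral>\<^sup>+\<omega>. ennreal_powr (stationary_max_dater f (\<lambda>k. \<zeta> k \<omega>) (\<lambda>k. T k \<omega>)) (\<alpha> - 1) \<partial>M) < \<infinity>"
proof -
  have "gamma0 M f \<zeta> < 1 / rate"
    using stability rate_pos by (simp add: field_simps)
  then obtain r where r: "expectation (R 1 (1 + int r)) < real (Suc r) * (1 / rate)"
    by (rule gamma0_less_imp_block)
  define L where "L = Suc r"
  \<comment> \<open>\<open>S\<close> and \<open>D\<close> describe the block of \<open>L\<close>
    customers that follows customer \<open>0\<close>.\<close>
  define S where "S = R 1 (1 + int r)"
  define D where "D \<omega> = T (0 + int L) \<omega> - T 0 \<omega>" for \<omega>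
  have S [measurable]: "S \<in> borel_measurable M" and [measurable]: "D \<in> borel_measurable M"
    unfolding S_def D_def by (auto intro: R_measurable)
  have nonneg: "0 \<le> S \<omega>" "0 \<le> D \<omega>" if "\<omega> \<in> space M" for \<omega>
    using R_nonneg[OF that] monoD[OF epochs_mono[OF that], of 0 "int L"] by (auto simp: S_def D_def)
  have int: "integrable M S" "integrable M D"
    unfolding S_def D_def by (rule R_integrable epoch_diff_integrable)+
  have int_powr: "integrable M (\<lambda>\<omega>. S \<omega> powr \<alpha>)"
    unfolding S_def using \<open>1 < \<alpha>\<close> moment by (rule R_powr_integrable)
  have "expectation S < expectation D"
    using r unfolding S_def D_def expectation_epoch_diff by (simp add: L_def)
  then obtain c C where cC: "0 < c" "0 \<le> C"
    and drift: "\<And>u. 0 \<le> u \<Longrightarrow> (\<integral>\<^sup>+\<omega>. ennreal ((S \<omega> + max 0 (u - D \<omega>)) powr \<alpha>) \<partial>M)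
      + ennreal (c * u powr (\<alpha> - 1)) \<le> ennreal (u powr \<alpha> + C)"
    using queue_drift[OF S nonneg int int_powr \<open>1 < \<alpha>\<close>] by blast
  \<comment> \<open>\<open>V\<close> runs forward from customer \<open>0\<close>, where the
    recursion appends a block; \<open>A\<close> runs backward from it, where the daters increase.
    Shift invariance connects the two directions.\<close>
  define V where "V k = (\<integral>\<^sup>+\<omega>. ennreal (Z 0 (int (k * L)) \<omega> powr \<alpha>) \<partial>M)" for k
  define A where "A n = (\<integral>\<^sup>+\<omega>. ennreal (Z (- int n) 0 \<omega> powr (\<alpha> - 1)) \<partial>M)" for n
  have inc: "incseq (\<lambda>n. Z (- int n) 0 \<omega>)" if "\<omega> \<in> space M" for \<omega>
    using that by (intro incseq_max_dater[OF separable epochs_mono])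
  have inc_powr: "incseq (\<lambda>n. Z (- int n) 0 \<omega> powr (\<alpha> - 1))" if "\<omega> \<in> space M" for \<omega>
    using incseqD[OF inc[OF that]] Z_nonneg[OF that] \<open>1 < \<alpha>\<close> by (intro monoI powr_mono2) auto
  have "incseq A"
    unfolding A_def using incseqD[OF inc_powr] by (intro monoI nn_integral_mono ennreal_leI) auto
  have step: "V (Suc k) + ennreal c * A (k * L) \<le> V k + ennreal C" for k
  proof -
    define U where "U = Z 0 (int (k * L))"
    have [measurable]: "U \<in> borel_measurable M"
      unfolding U_def by (rule Z_measurable) simp
    have U_nonneg: "0 \<le> U \<omega>" if "\<omega> \<in> space M" for \<omega>
      unfolding U_def using that by (rule Z_nonneg) simp
    have A: "A (k * L) = (\<integral>\<^sup>+\<omega>. ennreal (U \<omega> powr (\<alpha> - 1)) \<partial>M)"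
      using nn_integral_Z_shift[of "- int (k * L)" "k * L" "\<alpha> - 1" 0] by (simp add: A_def U_def)
    have V: "V k = (\<integral>\<^sup>+\<omega>. ennreal (U \<omega> powr \<alpha>) \<partial>M)"
      by (simp only: V_def U_def)
    have "V (Suc k) \<le> (\<integral>\<^sup>+\<omega>. (\<integral>\<^sup>+\<omega>'. ennreal ((S \<omega>' + max 0 (U \<omega> - D \<omega>')) powr \<alpha>) \<partial>M) \<partial>M)"
      using nn_integral_Z_recursion[of \<alpha> "k * L" r] \<open>1 < \<alpha>\<close>
      unfolding V_def U_def S_def D_def by (simp only: L_def mult_Suc add.commute)
    then have "V (Suc k) + ennreal c * A (k * L)
      \<le> (\<integral>\<^sup>+\<omega>. (\<integral>\<^sup>+\<omega>'. ennreal ((S \<omega>' + max 0 (U \<omega> - D \<omega>')) powr \<alpha>) \<partial>M) \<partial>M)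
        + (\<integral>\<^sup>+\<omega>. ennreal (c * U \<omega> powr (\<alpha> - 1)) \<partial>M)"
      using cC by (intro add_mono) (simp_all add: A nn_integral_cmult ennreal_mult)
    also have "\<dots> = (\<integral>\<^sup>+\<omega>. (\<integral>\<^sup>+\<omega>'. ennreal ((S \<omega>' + max 0 (U \<omega> - D \<omega>')) powr \<alpha>) \<partial>M)
        + ennreal (c * U \<omega> powr (\<alpha> - 1)) \<partial>M)"
      by (rule nn_integral_add[symmetric]) measurable
    \<comment> \<open>The drift inequality is applied with \<open>u = U \<omega>\<close> at the
      outer sample point and then integrated.\<close>
    also have "\<dots> \<le> (\<integral>\<^sup>+\<omega>. ennreal (U \<omega> powr \<alpha>) + ennreal C \<partial>M)"
      using drift[OF U_nonneg] cC by (intro nn_integral_mono) (simp add: ennreal_plus)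
    also have "\<dots> = V k + ennreal C"
      by (simp add: nn_integral_add V emeasure_space_1)
    finally show ?thesis .
  qed
  have inc_A: "incseq (\<lambda>k. A (k * L))"
    using \<open>incseq A\<close> by (intro monoI) (auto simp: incseq_def)
  have "V 0 < \<infinity>"
    using moment by (simp add: V_def nn_integral_eq_integral)
  from ennreal_drift_bound[of V c "\<lambda>k. A (k * L)" C, OF step inc_A this cC]
  obtain B where B: "B < \<infinity>" "\<And>k. A (k * L) \<le> B"
    by blast
  have "(\<integral>\<^sup>+\<omega>. ennreal_powr (stationary_max_dater f (\<lambda>k. \<zeta> k \<omega>) (\<lambda>k. T k \<omega>)) (\<alpha> - 1) \<partial>M)
    \<le> (\<integral>\<^sup>+\<omega>. (SUP n. ennreal (Z (- int n) 0 \<omega> powr (\<alpha> - 1))) \<partial>M)"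
    unfolding stationary_max_dater_def using \<open>1 < \<alpha>\<close>
    by (intro nn_integral_mono ennreal_powr_lim_le inc Z_nonneg) auto
  also have "\<dots> = (SUP n. A n)"
    unfolding A_def
  proof (rule nn_integral_monotone_convergence_SUP_AE)
    show "AE \<omega> in M. ennreal (Z (- int n) 0 \<omega> powr (\<alpha> - 1)) \<le> ennreal (Z (- int (Suc n)) 0 \<omega> powr (\<alpha> - 1))" for n
      using incseq_SucD[OF inc_powr] by (intro AE_I2 ennreal_leI) auto
    show "(\<lambda>\<omega>. ennreal (Z (- int n) 0 \<omega> powr (\<alpha> - 1))) \<in> borel_measurable M" for n
      by (intro measurable_compose[OF _ measurable_ennreal] powr_real_measurable Z_measurable borel_measurable_const) simp
  qed
  also have "\<dots> \<le> B"
  proof (rule SUP_least)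
    fix n
    \<comment> \<open>The bound is known along multiples of \<open>L\<close> only; since
      \<open>L\<close> is positive, \<open>n <= n * L\<close>.\<close>
    have "A n \<le> A (n * L)"
      by (rule incseqD[OF \<open>incseq A\<close>]) (simp add: L_def)
    then show "A n \<le> B"
      using B(2) by (rule order_trans)
  qed
  finally show ?thesis
    using B(1) by (rule le_less_trans)
qed

end

theorem corollary4:
  fixes M :: "'a measure" and K :: "'k measure" and f :: "'k functional"
    and T :: "int \<Rightarrow> 'a \<Rightarrow> real" and \<zeta> :: "int \<Rightarrow> 'a \<Rightarrow> 'k" and rate \<alpha> :: real
  assumes network: "monotone_separable_network M K f T \<zeta> rate"
    and independence: "IA M K T \<zeta>"
    and stability: "rate * gamma0 M f \<zeta> < 1"
    and alpha: "\<alpha> > 1"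
    and moment: "integrable M (\<lambda>\<omega>. max_dater f (\<lambda>k. \<zeta> k \<omega>) 0 0 (\<lambda>k. T k \<omega>) powr \<alpha>)"
  shows "(\<integral>\<^sup>+\<omega>. ennreal_powr (stationary_max_dater f (\<lambda>k. \<zeta> k \<omega>) (\<lambda>k. T k \<omega>)) (\<alpha> - 1) \<partial>M) < \<infinity>"
proof -
  interpret iid_network M K f T \<zeta> rate
    using network independence by (simp add: iid_network_def iid_network_axioms_def)
  show ?thesis
    using stability alpha moment by (rule stationary_max_dater_moment)
qed

end
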